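(* Let $\xi=(\xi(\theta),\theta\in\mathcal T)$ and $\zeta=(\zeta(\theta),\theta\in\mathcal T)$ be two admissible families such that $E[\operatorname{ess\,sup}_{\theta\in\mathcal T}(\xi(\theta))^-]<+\infty$, $E[\operatorname{ess\,sup}_{\theta\in\mathcal T}(\zeta(\theta))^+]<+\infty$, and $\xi(T)=\zeta(T)=0$ a.s. Let $J$ and $J'$ be the families associated with $\xi,\zeta$ as defined in the context. Then $J$ and $J'$ are nonnegative supermartingale families which satisfy $J=\mathcal R(J'+\xi)$ and $J'=\mathcal R(J-\zeta)$, that is, for each $\theta\in\mathcal T$, $$J(\theta)=\operatorname*{ess\,sup}_{\tau\in\mathcal T_\theta}E[J'(\tau)+\xi(\tau)\mid\mathcal F_\theta]\ \text{a.s.},\qquad J'(\theta)=\operatorname*{ess\,sup}_{\sigma\in\mathcal T_\theta}E[J(\sigma)-\zeta(\sigma)\mid\mathcal F_\theta]\ \text{a.s.}$$ Moreover, $J$ and $J'$ are minimal in the following sense: if $H$ and $H'$ are two nonnegative supermartingale families such that $H\ge H'+\xi$ and $H'\ge H-\zeta$, then $J\le H$ and $J'\le H'$.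
   Context: Let $(\Omega,\mathcal F,(\mathcal F_t)_{0\le t\le T},P)$ be a filtered probability space satisfying the usual conditions (right-continuity and completeness), with $\mathcal F=\mathcal F_T$, $\mathcal F_0$ containing only sets of probability $0$ or $1$, and a fixed horizon $T\in(0,\infty)$. $\mathcal T$ is the set of stopping times with values in $[0,T]$; for a stopping time $S$, $\mathcal T_S=\{\theta\in\mathcal T:\theta\ge S\text{ a.s.}\}$. A family $\phi=(\phi(\theta),\theta\in\mathcal T)$ of $\overline{\mathbb R}$-valued random variables is admissible if each $\phi(\theta)$ is $\mathcal F_\theta$-measurable and $\phi(\theta)=\phi(\theta')$ a.s. on $\{\theta=\theta'\}$ for all $\theta,\theta'\in\mathcal T$. For families, $\phi\ge\phi'$ means $\phi(\theta)\ge\phi'(\theta)$ a.s. for each $\theta\in\mathcal T$ (similarly $\le$, $=$). An admissible family $\phi$ with $E[\operatorname{ess\,sup}_{\theta\in\mathcal T}\phi(\theta)^-]<\infty$ is a supermartingale family if $E[\phi(\theta)\mid\mathcal F_{\theta'}]\le\phi(\theta')$ a.s. for all $\theta,\theta'\in\mathcal T$ with $\theta\ge\theta'$ a.s. For such an admissible $\phi$, the Snell envelope $\mathcal R(\phi)$ is the family $\mathcal R(\phi)(S)=\operatorname{ess\,sup}_{\theta\in\mathcal T_S}E[\phi(\theta)\mid\mathcal F_S]$, $S\in\mathcal T$. The families $J,J'$: set $J_0(\theta)=J'_0(\theta)=0$ and for $n\ge0$, $J_{n+1}(\theta)=\operatorname{ess\,sup}_{\tau\in\mathcal T_\theta}E[J'_n(\tau)+\xi(\tau)\mid\mathcal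 F_\theta]$, $J'_{n+1}(\theta)=\operatorname{ess\,sup}_{\sigma\in\mathcal T_\theta}E[J_n(\sigma)-\zeta(\sigma)\mid\mathcal F_\theta]$; then $J(\theta)=\limsup_{n\to\infty}J_n(\theta)$ and $J'(\theta)=\limsup_{n\to\infty}J'_n(\theta)$. *)

theory Defs
  imports "HOL-Probability.Probability"
begin

definition usual_filtered_space ::
  "'a measure \<Rightarrow> (real \<Rightarrow> 'a measure) \<Rightarrow> real \<Rightarrow> bool" where
  "usual_filtered_space M F T \<longleftrightarrow>
     prob_space M \<and> 0 < T \<and>
     (\<forall>t\<in>{0..T}. space (F t) = space M \<and> sets (F t) \<subseteq> sets M) \<and>
     (\<forall>s\<in>{0..T}. \<forall>t\<in>{0..T}. s \<le> t \<longrightarrow> sets (F s) \<subseteq> sets (F t)) \<and>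
     sets (F T) = sets M \<and>
     \<comment> \<open>right-continuity\<close>
     (\<forall>t\<in>{0..<T}. sets (F t) = (\<Inter>s\<in>{t<..T}. sets (F s))) \<and>
     \<comment> \<open>completeness: F 0 contains all subsets of P-null sets\<close>
     (\<forall>A. A \<subseteq> space M \<and> (\<exists>N\<in>null_sets M. A \<subseteq> N) \<longrightarrow> A \<in> sets (F 0)) \<and>
     \<comment> \<open>F 0 contains only sets of probability 0 or 1\<close>
     (\<forall>A\<in>sets (F 0). emeasure M A = 0 \<or> emeasure M A = 1)"

definition stopT :: "'a measure \<Rightarrow> (real \<Rightarrow> 'a measure) \<Rightarrow> real \<Rightarrow> ('a \<Rightarrow> real) \<Rightarrow> bool" where
  "stopT M F T \<theta> \<longleftrightarrow> stopping_time F \<theta> \<and> (\<forall>\<omega>\<in>space M. 0 \<le> \<theta> \<omega> \<and> \<theta> \<omega> \<le> T)"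

definition stopT_from :: "'a measure \<Rightarrow> (real \<Rightarrow> 'a measure) \<Rightarrow> real \<Rightarrow> ('a \<Rightarrow> real) \<Rightarrow> ('a \<Rightarrow> real) set" where
  "stopT_from M F T S = {\<theta>. stopT M F T \<theta> \<and> (AE \<omega> in M. S \<omega> \<le> \<theta> \<omega>)}"

definition F_at :: "'a measure \<Rightarrow> (real \<Rightarrow> 'a measure) \<Rightarrow> real \<Rightarrow> ('a \<Rightarrow> real) \<Rightarrow> 'a measure" where
  "F_at M F T \<theta> = sigma (space M)
     {A. A \<in> sets M \<and> (\<forall>t\<in>{0..T}. {\<omega>\<in>A. \<theta> \<omega> \<le> t} \<in> sets (F t))}"

text \<open>E[X | N] = E[X^+ | N] - E[X^- | N].\<close>
definition cexp :: "'a measure \<Rightarrow> 'a measure \<Rightarrow> ('a \<Rightarrow> ereal) \<Rightarrow> 'a \<Rightarrow> ereal" where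
  "cexp M N X = (\<lambda>\<omega>. enn2ereal (nn_cond_exp M N (\<lambda>x. e2ennreal (X x)) \<omega>)
                    - enn2ereal (nn_cond_exp M N (\<lambda>x. e2ennreal (- X x)) \<omega>))"

definition ess_sup_fam :: "'a measure \<Rightarrow> 'a measure \<Rightarrow> 'i set \<Rightarrow> ('i \<Rightarrow> 'a \<Rightarrow> ereal) \<Rightarrow> 'a \<Rightarrow> ereal" where
  "ess_sup_fam M N I X = (SOME Y. Y \<in> borel_measurable N \<and>
      (\<forall>i\<in>I. AE \<omega> in M. X i \<omega> \<le> Y \<omega>) \<and>
      (\<forall>Z\<in>borel_measurable M. (\<forall>i\<in>I. AE \<omega> in M. X i \<omega> \<le> Z \<omega>) \<longrightarrow> (AE \<omega> in M. Y \<omega> \<le> Z \<omega>)))"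

type_synonym 'a family = "('a \<Rightarrow> real) \<Rightarrow> 'a \<Rightarrow> ereal"

definition admissible :: "'a measure \<Rightarrow> (real \<Rightarrow> 'a measure) \<Rightarrow> real \<Rightarrow> 'a family \<Rightarrow> bool" where
  "admissible M F T \<phi> \<longleftrightarrow>
     (\<forall>\<theta>. stopT M F T \<theta> \<longrightarrow> \<phi> \<theta> \<in> borel_measurable (F_at M F T \<theta>)) \<and>
     (\<forall>\<theta> \<theta>'. stopT M F T \<theta> \<longrightarrow> stopT M F T \<theta>' \<longrightarrow>
        (AE \<omega> in M. \<theta> \<omega> = \<theta>' \<omega> \<longrightarrow> \<phi> \<theta> \<omega> = \<phi> \<theta>' \<omega>))"

definition negpart :: "ereal \<Rightarrow> ereal" where "negpart x = max 0 (- x)"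
definition pospart :: "ereal \<Rightarrow> ereal" where "pospart x = max 0 x"

definition int_esssup :: "'a measure \<Rightarrow> (real \<Rightarrow> 'a measure) \<Rightarrow> real \<Rightarrow> (ereal \<Rightarrow> ereal) \<Rightarrow> 'a family \<Rightarrow> bool" where
  "int_esssup M F T f \<phi> \<longleftrightarrow>
     (\<integral>\<^sup>+ \<omega>. e2ennreal (ess_sup_fam M M {\<theta>. stopT M F T \<theta>} (\<lambda>\<theta> x. f (\<phi> \<theta> x)) \<omega>) \<partial>M) < \<infinity>"

definition supermart_family :: "'a measure \<Rightarrow> (real \<Rightarrow> 'a measure) \<Rightarrow> real \<Rightarrow> 'a family \<Rightarrow> bool" where
  "supermart_family M F T \<phi> \<longleftrightarrow>
     admissible M F T \<phi> \<and> int_esssup M F T negpart \<phi> \<and>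
     (\<forall>\<theta> \<theta>'. stopT M F T \<theta> \<longrightarrow> stopT M F T \<theta>' \<longrightarrow> (AE \<omega> in M. \<theta>' \<omega> \<le> \<theta> \<omega>) \<longrightarrow>
        (AE \<omega> in M. cexp M (F_at M F T \<theta>') (\<phi> \<theta>) \<omega> \<le> \<phi> \<theta>' \<omega>))"

definition snell :: "'a measure \<Rightarrow> (real \<Rightarrow> 'a measure) \<Rightarrow> real \<Rightarrow> 'a family \<Rightarrow> 'a family" where
  "snell M F T \<phi> S = ess_sup_fam M (F_at M F T S) (stopT_from M F T S)
      (\<lambda>\<theta>. cexp M (F_at M F T S) (\<phi> \<theta>))"

definition fam_le :: "'a measure \<Rightarrow> (real \<Rightarrow> 'a measure) \<Rightarrow> real \<Rightarrow> 'a family \<Rightarrow> 'a family \<Rightarrow> bool" where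
  "fam_le M F T \<phi> \<psi> \<longleftrightarrow> (\<forall>\<theta>. stopT M F T \<theta> \<longrightarrow> (AE \<omega> in M. \<phi> \<theta> \<omega> \<le> \<psi> \<theta> \<omega>))"

definition fam_eq :: "'a measure \<Rightarrow> (real \<Rightarrow> 'a measure) \<Rightarrow> real \<Rightarrow> 'a family \<Rightarrow> 'a family \<Rightarrow> bool" where
  "fam_eq M F T \<phi> \<psi> \<longleftrightarrow> (\<forall>\<theta>. stopT M F T \<theta> \<longrightarrow> (AE \<omega> in M. \<phi> \<theta> \<omega> = \<psi> \<theta> \<omega>))"

fun Jseq :: "'a measure \<Rightarrow> (real \<Rightarrow> 'a measure) \<Rightarrow> real \<Rightarrow> 'a family \<Rightarrow> 'a family \<Rightarrow> nat
             \<Rightarrow> 'a family \<times> 'a family" where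
  "Jseq M F T \<xi> \<zeta> 0 = ((\<lambda>\<theta> \<omega>. 0), (\<lambda>\<theta> \<omega>. 0))"
| "Jseq M F T \<xi> \<zeta> (Suc n) =
     (snell M F T (\<lambda>\<tau> \<omega>. snd (Jseq M F T \<xi> \<zeta> n) \<tau> \<omega> + \<xi> \<tau> \<omega>),
      snell M F T (\<lambda>\<sigma> \<omega>. fst (Jseq M F T \<xi> \<zeta> n) \<sigma> \<omega> - \<zeta> \<sigma> \<omega>))"

definition Jfam :: "'a measure \<Rightarrow> (real \<Rightarrow> 'a measure) \<Rightarrow> real \<Rightarrow> 'a family \<Rightarrow> 'a family \<Rightarrow> 'a family" where
  "Jfam M F T \<xi> \<zeta> = (\<lambda>\<theta> \<omega>. limsup (\<lambda>n. fst (Jseq M F T \<xi> \<zeta> n) \<theta> \<omega>))"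

definition Jfam' :: "'a measure \<Rightarrow> (real \<Rightarrow> 'a measure) \<Rightarrow> real \<Rightarrow> 'a family \<Rightarrow> 'a family \<Rightarrow> 'a family" where
  "Jfam' M F T \<xi> \<zeta> = (\<lambda>\<theta> \<omega>. limsup (\<lambda>n. snd (Jseq M F T \<xi> \<zeta> n) \<theta> \<omega>))"

end

theory Submission
  imports Defs
begin

text \<open>Adding a nonnegative family to \<open>\<xi>\<close> or to \<open>- \<zeta>\<close> keeps the negative parts integrable, and both
  vanish at the horizon; hence the iterates are nonnegative and, by monotonicity of the Snell
  envelope, increasing. Monotone convergence for conditional expectations then lets the limit pass
  through each Snell envelope, which gives the fixed point equations. A Snell envelope is a
  supermartingale family because conditional expectations over the stopping times after \<open>S\<close> are
  directed upwards, so that the essential supremum is an increasing limit. Minimality is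
  inherited from the iterates, since a supermartingale family dominating a reward dominates its
  Snell envelope.\<close>

section \<open>Essential suprema\<close>

text \<open>Two difficulties shape the proof: every object is fixed only up to null sets, and values
  may be infinite. An essential supremum is an arbitrarily chosen version, so its existence has to
  be secured first, by countable exhaustion, and families are compared at one stopping time at a
  time, discarding countably many null sets. A conditional expectation is a difference of two
  conditional expectations with values in [0, \<infinity>], so linearity is lost where both are
  infinite; integrable negative parts exclude this, while J and J' may still take the value
  \<infinity>. Finally, admissibility is not built into the Snell envelope. It rests on the
  sigma-algebras at \<theta> and \<theta>' having the same trace on {\<theta> = \<theta>'}, so that
  conditioning on either gives the same result there.\<close>

lemma (in finite_measure) countable_essential_union:
  assumes A: "\<And>i. i \<in> I \<Longrightarrow> A i \<in> sets M"
  shows "\<exists>C\<subseteq>I. countable C \<and> (\<forall>i\<in>I. A i - (\<Union>j\<in>C. A j) \<in> null_sets M)"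
proof -
  define \<C> where "\<C> = {C. C \<subseteq> I \<and> countable C}"
  have UN: "(\<Union>j\<in>C. A j) \<in> sets M" if "C \<in> \<C>" for C
    using that A unfolding \<C>_def by (intro sets.countable_UN'') auto
  \<comment> \<open>Exhaustion: \<open>m\<close> is the largest mass that countable unions approach.
    Pooling a maximising sequence of countable index sets attains it, so a further
    \<open>A i\<close> cannot add mass.\<close>
  define m where "m = (SUP C\<in>\<C>. emeasure M (\<Union>j\<in>C. A j))"
  have "{} \<in> \<C>"
    by (simp add: \<C>_def)
  then obtain f :: "nat \<Rightarrow> ennreal"
    where f: "range f \<subseteq> (\<lambda>C. emeasure M (\<Union>j\<in>C. A j)) ` \<C>" "m = (SUP n. f n)"
    using ennreal_Sup_countable_SUP[of "(\<lambda>C. emeasure M (\<Union>j\<in>C. A j)) ` \<C>"]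
    unfolding m_def by blast
  have "\<forall>n. \<exists>C\<in>\<C>. f n = emeasure M (\<Union>j\<in>C. A j)"
    using f(1) by blast
  then obtain D where D: "\<And>n. D n \<in> \<C>" "\<And>n. f n = emeasure M (\<Union>j\<in>D n. A j)"
    by metis
  define C where "C = (\<Union>n. D n)"
  have C: "C \<in> \<C>"
    using D(1) unfolding C_def \<C>_def by auto
  have le_m: "emeasure M (\<Union>j\<in>B. A j) \<le> m" if "B \<in> \<C>" for B
    unfolding m_def using that by (rule SUP_upper)
  have "m \<le> emeasure M (\<Union>j\<in>C. A j)"
    unfolding f(2) D(2) by (intro SUP_least emeasure_mono UN C) (auto simp: C_def)
  then have m: "emeasure M (\<Union>j\<in>C. A j) = m"
    using le_m[OF C] by simp
  have "A i - (\<Union>j\<in>C. A j) \<in> null_sets M" if "i \<in> I" for i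
  proof -
    let ?U = "\<Union>j\<in>C. A j"
    have "emeasure M ?U + emeasure M (A i - ?U) = emeasure M (?U \<union> (A i - ?U))"
      using that A UN[OF C] by (intro plus_emeasure) auto
    also have "?U \<union> (A i - ?U) = (\<Union>j\<in>insert i C. A j)"
      by auto
    also have "emeasure M \<dots> \<le> m"
      using C that by (intro le_m) (auto simp: \<C>_def)
    \<comment> \<open>Cancelling the mass of \<open>?U\<close> is where finiteness of the measure
      enters.\<close>
    finally have "emeasure M (A i - ?U) = 0"
      using m emeasure_finite[of ?U]
      by (metis add.right_neutral ennreal_add_left_cancel_le infinity_ennreal_def le_zero_eq)
    then show ?thesis
      using that A UN[OF C] by auto
  qed
  then show ?thesis
    using C unfolding \<C>_def by auto
qed

text \<open>Reduces functions to their level sets above rationals: where \<open>X i\<close> exceeds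
  the countable supremum, some rational lies strictly between, and the point is in a level set of
  \<open>X i\<close> missed by all selected indices.\<close>

lemma (in finite_measure) countable_essential_supremum:
  fixes X :: "'i \<Rightarrow> 'a \<Rightarrow> ereal"
  assumes X[measurable]: "\<And>i. i \<in> I \<Longrightarrow> X i \<in> borel_measurable M"
  shows "\<exists>C\<subseteq>I. countable C \<and> (\<forall>i\<in>I. AE \<omega> in M. X i \<omega> \<le> (SUP j\<in>C. X j \<omega>))"
proof -
  define A where "A q i = {\<omega>\<in>space M. ereal (real_of_rat q) < X i \<omega>}" for q i
  have "\<forall>q. \<exists>C\<subseteq>I. countable C \<and> (\<forall>i\<in>I. A q i - (\<Union>j\<in>C. A q j) \<in> null_sets M)"
    by (intro allI countable_essential_union) (auto simp: A_def)
  then obtain C where C: "\<And>q. C q \<subseteq> I" "\<And>q. countable (C q)"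
    "\<And>q i. i \<in> I \<Longrightarrow> A q i - (\<Union>j\<in>C q. A q j) \<in> null_sets M"
    by metis
  have "AE \<omega> in M. X i \<omega> \<le> (SUP j\<in>(\<Union>q. C q). X j \<omega>)" if "i \<in> I" for i
  proof -
    have "AE \<omega> in M. \<forall>q. \<omega> \<notin> A q i - (\<Union>j\<in>C q. A q j)"
      unfolding AE_all_countable using C(3)[OF that] by (intro allI AE_not_in)
    with AE_space show ?thesis
    proof eventually_elim
      case (elim \<omega>)
      show ?case
      proof (rule ccontr)
        assume "\<not> X i \<omega> \<le> (SUP j\<in>(\<Union>q. C q). X j \<omega>)"
        then obtain q where q: "(SUP j\<in>(\<Union>q. C q). X j \<omega>) < ereal (real_of_rat q)"
          "ereal (real_of_rat q) < X i \<omega>"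
          using ereal_dense3 by (metis not_le)
        then obtain j where j: "j \<in> C q" "ereal (real_of_rat q) < X j \<omega>"
          using elim(1) elim(2)[rule_format, of q] by (auto simp: A_def)
        moreover have "X j \<omega> \<le> (SUP j\<in>(\<Union>q. C q). X j \<omega>)"
          using j(1) by (intro SUP_upper) auto
        ultimately show False
          using q(1) by auto
      qed
    qed
  qed
  then show ?thesis
    using C by (intro exI[of _ "\<Union>q. C q"]) auto
qed

text \<open>A countable supremum is a witness for the choice operator. It inherits measurability
  from \<open>N\<close>, while minimality is tested against all \<open>M\<close>-measurable bounds,
  so asking for an \<open>N\<close>-measurable version does not enlarge the essential
  supremum.\<close>

lemma (in finite_measure) ess_sup_fam_characterization:
  fixes X :: "'i \<Rightarrow> 'a \<Rightarrow> ereal"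
  assumes N: "subalgebra M N" and X: "\<And>i. i \<in> I \<Longrightarrow> X i \<in> borel_measurable N"
  shows "ess_sup_fam M N I X \<in> borel_measurable N \<and>
    (\<forall>i\<in>I. AE \<omega> in M. X i \<omega> \<le> ess_sup_fam M N I X \<omega>) \<and>
    (\<forall>Z\<in>borel_measurable M. (\<forall>i\<in>I. AE \<omega> in M. X i \<omega> \<le> Z \<omega>) \<longrightarrow>
      (AE \<omega> in M. ess_sup_fam M N I X \<omega> \<le> Z \<omega>))"
proof -
  have XM: "X i \<in> borel_measurable M" if "i \<in> I" for i
    using measurable_from_subalg[OF N X[OF that]] .
  obtain C where C: "C \<subseteq> I" "countable C"
    "\<And>i. i \<in> I \<Longrightarrow> AE \<omega> in M. X i \<omega> \<le> (SUP j\<in>C. X j \<omega>)"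
    using countable_essential_supremum[of I X, OF XM] by blast
  show ?thesis
    unfolding ess_sup_fam_def
  proof (rule someI[where x="\<lambda>\<omega>. SUP j\<in>C. X j \<omega>"], intro conjI ballI impI)
    show "(\<lambda>\<omega>. SUP j\<in>C. X j \<omega>) \<in> borel_measurable N"
      using C X by (intro borel_measurable_SUP) auto
    fix Z :: "'a \<Rightarrow> ereal"
    assume "\<forall>i\<in>I. AE \<omega> in M. X i \<omega> \<le> Z \<omega>"
    then have "AE \<omega> in M. \<forall>i\<in>C. X i \<omega> \<le> Z \<omega>"
      using C by (subst AE_ball_countable) auto
    then show "AE \<omega> in M. (SUP j\<in>C. X j \<omega>) \<le> Z \<omega>"
      by eventually_elim (auto intro: SUP_least)
  qed (use C in auto)
qed

lemma (in finite_measure)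
  fixes X :: "'i \<Rightarrow> 'a \<Rightarrow> ereal"
  assumes N: "subalgebra M N" and X: "\<And>i. i \<in> I \<Longrightarrow> X i \<in> borel_measurable N"
  shows ess_sup_fam_measurable: "ess_sup_fam M N I X \<in> borel_measurable N"
    and ess_sup_fam_upper: "i \<in> I \<Longrightarrow> AE \<omega> in M. X i \<omega> \<le> ess_sup_fam M N I X \<omega>"
    and ess_sup_fam_least: "Z \<in> borel_measurable M \<Longrightarrow> (\<And>i. i \<in> I \<Longrightarrow> AE \<omega> in M. X i \<omega> \<le> Z \<omega>) \<Longrightarrow>
      AE \<omega> in M. ess_sup_fam M N I X \<omega> \<le> Z \<omega>"
  using ess_sup_fam_characterization[where I=I and X=X, OF N X] by simp_all

text \<open>Dependent choice builds \<open>s\<close> so that each term dominates its predecessor and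
  the next member of an enumeration of a countable set that already determines the essential
  supremum.\<close>

lemma (in finite_measure) ess_sup_fam_directed:
  fixes X :: "'i \<Rightarrow> 'a \<Rightarrow> ereal"
  assumes N: "subalgebra M N" and X: "\<And>i. i \<in> I \<Longrightarrow> X i \<in> borel_measurable N"
    and "I \<noteq> {}"
    and dir: "\<And>i j. i \<in> I \<Longrightarrow> j \<in> I \<Longrightarrow>
      \<exists>k\<in>I. (AE \<omega> in M. X i \<omega> \<le> X k \<omega>) \<and> (AE \<omega> in M. X j \<omega> \<le> X k \<omega>)"
  shows "\<exists>s :: nat \<Rightarrow> 'i. (\<forall>n. s n \<in> I) \<and> (\<forall>n. AE \<omega> in M. X (s n) \<omega> \<le> X (s (Suc n)) \<omega>) \<and>
    (AE \<omega> in M. ess_sup_fam M N I X \<omega> = (SUP n. X (s n) \<omega>))"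
proof -
  have XM: "X i \<in> borel_measurable M" if "i \<in> I" for i
    using measurable_from_subalg[OF N X[OF that]] .
  obtain C0 where C0: "C0 \<subseteq> I" "countable C0"
    "\<And>i. i \<in> I \<Longrightarrow> AE \<omega> in M. X i \<omega> \<le> (SUP j\<in>C0. X j \<omega>)"
    using countable_essential_supremum[of I X, OF XM] by blast
  obtain i0 where i0: "i0 \<in> I"
    using \<open>I \<noteq> {}\<close> by auto
  \<comment> \<open>\<open>i0\<close> keeps the set nonempty, so that \<open>from_nat_into\<close>
    enumerates exactly \<open>C\<close>.\<close>
  define C where "C = insert i0 C0"
  have C: "C \<subseteq> I" "countable C" "C \<noteq> {}"
    using C0 i0 by (auto simp: C_def)
  define c where "c = from_nat_into C"
  have cI: "c n \<in> I" for n
    using C from_nat_into[of C n] by (auto simp: c_def)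
  have range_c: "range c = C"
    using C by (simp add: c_def)
  have "\<exists>s. \<forall>n. (s n \<in> I \<and> (AE \<omega> in M. X (c n) \<omega> \<le> X (s n) \<omega>)) \<and>
      (AE \<omega> in M. X (s n) \<omega> \<le> X (s (Suc n)) \<omega>)"
  proof (rule dependent_nat_choice)
    show "\<exists>i. i \<in> I \<and> (AE \<omega> in M. X (c 0) \<omega> \<le> X i \<omega>)"
      using cI by auto
    show "\<exists>k. (k \<in> I \<and> (AE \<omega> in M. X (c (Suc n)) \<omega> \<le> X k \<omega>)) \<and> (AE \<omega> in M. X i \<omega> \<le> X k \<omega>)"
      if "i \<in> I \<and> (AE \<omega> in M. X (c n) \<omega> \<le> X i \<omega>)" for i n
      using dir[of i "c (Suc n)"] that cI by blast
  qed
  then obtain s where s: "\<And>n. s n \<in> I" "\<And>n. AE \<omega> in M. X (c n) \<omega> \<le> X (s n) \<omega>"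
    "\<And>n. AE \<omega> in M. X (s n) \<omega> \<le> X (s (Suc n)) \<omega>"
    by metis
  have [measurable]: "(\<lambda>\<omega>. SUP n. X (s n) \<omega>) \<in> borel_measurable M"
    using XM s(1) by (intro borel_measurable_SUP) auto
  have "AE \<omega> in M. X i \<omega> \<le> (SUP n. X (s n) \<omega>)" if "i \<in> I" for i
  proof -
    have "AE \<omega> in M. \<forall>n. X (c n) \<omega> \<le> X (s n) \<omega>"
      using s(2) by (simp add: AE_all_countable)
    with C0(3)[OF that] show ?thesis
    proof eventually_elim
      case (elim \<omega>)
      have "(SUP j\<in>C0. X j \<omega>) \<le> (SUP j\<in>C. X j \<omega>)"
        by (intro SUP_subset_mono) (auto simp: C_def)
      also have "\<dots> = (SUP n. X (c n) \<omega>)"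
        by (simp add: image_image flip: range_c)
      also have "\<dots> \<le> (SUP n. X (s n) \<omega>)"
        using elim by (intro SUP_mono) auto
      finally show ?case
        using elim by auto
    qed
  qed
  then have 1: "AE \<omega> in M. ess_sup_fam M N I X \<omega> \<le> (SUP n. X (s n) \<omega>)"
    by (intro ess_sup_fam_least N X) auto
  have "AE \<omega> in M. \<forall>n. X (s n) \<omega> \<le> ess_sup_fam M N I X \<omega>"
    unfolding AE_all_countable by (intro allI ess_sup_fam_upper N X s(1))
  with 1 have "AE \<omega> in M. ess_sup_fam M N I X \<omega> = (SUP n. X (s n) \<omega>)"
    by eventually_elim (auto intro!: antisym SUP_least)
  then show ?thesis
    using s by blast
qed

section \<open>Extended real conditional expectations\<close>

lemma enn2ereal_SUP:
  fixes f :: "nat \<Rightarrow> ennreal"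
  shows "enn2ereal (SUP n. f n) = (SUP n. enn2ereal (f n))"
proof (rule antisym)
  have "0 \<le> (SUP n. enn2ereal (f n))"
    by (rule order_trans[OF _ SUP_upper[of 0]]) auto
  moreover have "(SUP n. f n) \<le> e2ennreal (SUP n. enn2ereal (f n))"
    by (intro SUP_least) (metis SUP_upper UNIV_I e2ennreal_enn2ereal e2ennreal_mono)
  ultimately show "enn2ereal (SUP n. f n) \<le> (SUP n. enn2ereal (f n))"
    by (metis enn2ereal_e2ennreal less_eq_ennreal.rep_eq)
qed (auto intro!: SUP_least simp: less_eq_ennreal.rep_eq[symmetric] intro!: SUP_upper)

text \<open>Infinite values are covered: for infinite \<open>a\<close> the difference is
  \<infinity>, and \<open>e2ennreal\<close> truncates its negation to 0.\<close>

lemma e2ennreal_minus_le: "e2ennreal (- (enn2ereal a - enn2ereal b)) \<le> b"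
  by (cases a; cases b) (auto simp: e2ennreal_neg ennreal_leI)

text \<open>The relation between \<open>x\<close>, \<open>u\<close> and \<open>g\<close> freed of
  subtraction between them. In this form it passes through the additivity of nonnegative conditional
  expectations.\<close>

lemma ereal_shift_eq:
  assumes x: "x = enn2ereal u - enn2ereal g" and "g < \<infinity>"
  shows "e2ennreal x + g = u + e2ennreal (- x)"
proof -
  obtain r where r: "g = ennreal r" "0 \<le> r"
    using \<open>g < \<infinity>\<close> by (cases g) auto
  show ?thesis
  proof (cases u)
    case (real s)
    have "x = ereal (s - r)"
      using real r x by simp
    moreover have "ennreal (s - r) + ennreal r = ennreal s + ennreal (r - s)"
      using real r by (cases "r \<le> s") (simp_all add: ennreal_neg flip: ennreal_plus)
    ultimately show ?thesis
      using real r by simp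
  qed (use r x in \<open>simp add: e2ennreal_neg\<close>)
qed

context sigma_finite_subalgebra
begin

lemma cexp_measurable[measurable]: "cexp M F X \<in> borel_measurable F"
  unfolding cexp_def by measurable

lemma cexp_measurable2[measurable]: "cexp M F X \<in> borel_measurable M"
  unfolding cexp_def by measurable

lemma cexp_mono:
  assumes [measurable]: "X \<in> borel_measurable M" "Y \<in> borel_measurable M"
    and "AE x in M. X x \<le> Y x"
  shows "AE x in M. cexp M F X x \<le> cexp M F Y x"
proof -
  have "AE x in M. nn_cond_exp M F (\<lambda>x. e2ennreal (X x)) x \<le> nn_cond_exp M F (\<lambda>x. e2ennreal (Y x)) x"
    using assms(3) by (intro nn_cond_exp_mono) (auto elim!: eventually_mono intro: e2ennreal_mono)
  moreover have "AE x in M. nn_cond_exp M F (\<lambda>x. e2ennreal (- Y x)) x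
      \<le> nn_cond_exp M F (\<lambda>x. e2ennreal (- X x)) x"
    using assms(3) by (intro nn_cond_exp_mono) (auto elim!: eventually_mono intro: e2ennreal_mono)
  ultimately show ?thesis
    unfolding cexp_def
    by eventually_elim (auto intro!: ereal_minus_mono simp: less_eq_ennreal.rep_eq[symmetric])
qed

lemma cexp_cong_AE:
  assumes "X \<in> borel_measurable M" "Y \<in> borel_measurable M" "AE x in M. X x = Y x"
  shows "AE x in M. cexp M F X x = cexp M F Y x"
proof -
  have "AE x in M. cexp M F X x \<le> cexp M F Y x" "AE x in M. cexp M F Y x \<le> cexp M F X x"
    by (rule cexp_mono; use assms in \<open>auto elim: eventually_mono\<close>)+
  then show ?thesis
    by eventually_elim auto
qed

lemma nn_integral_nn_cond_exp:
  assumes [measurable]: "g \<in> borel_measurable M"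
  shows "(\<integral>\<^sup>+ x. nn_cond_exp M F g x \<partial>M) = (\<integral>\<^sup>+ x. g x \<partial>M)"
  using nn_cond_exp_intg[of "\<lambda>_. 1" g] by simp

lemma nn_cond_exp_finite:
  assumes [measurable]: "g \<in> borel_measurable M" and "(\<integral>\<^sup>+ x. g x \<partial>M) < \<infinity>"
  shows "AE x in M. nn_cond_exp M F g x < \<infinity>"
  using assms nn_integral_PInf_AE[of "nn_cond_exp M F g" M]
  by (auto simp: nn_integral_nn_cond_exp less_top)

text \<open>The conditional expectation may be computed from any decomposition into nonnegative parts
  whose subtrahend is integrable, not only from the canonical one.\<close>

lemma cexp_eq_diff:
  assumes [measurable]: "X \<in> borel_measurable M" "U \<in> borel_measurable M" "G \<in> borel_measurable M"
    and eq: "AE x in M. X x = enn2ereal (U x) - enn2ereal (G x)"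
    and fin: "(\<integral>\<^sup>+ x. G x \<partial>M) < \<infinity>"
  shows "AE x in M. cexp M F X x = enn2ereal (nn_cond_exp M F U x) - enn2ereal (nn_cond_exp M F G x)"
proof -
  let ?P = "\<lambda>x. e2ennreal (X x)" and ?N = "\<lambda>x. e2ennreal (- X x)"
  have G: "AE x in M. G x < \<infinity>"
    using nn_integral_PInf_AE[of G M] fin by (auto simp: less_top)
  \<comment> \<open>Integrability of \<open>G\<close> passes to the canonical negative part, so both
    subtrahends have finite conditional expectations and the additive identity can be turned back
    into an equality of differences.\<close>
  have "(\<integral>\<^sup>+ x. ?N x \<partial>M) \<le> (\<integral>\<^sup>+ x. G x \<partial>M)"
    using eq by (intro nn_integral_mono_AE) (auto elim!: eventually_mono simp: e2ennreal_minus_le)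
  then have N: "(\<integral>\<^sup>+ x. ?N x \<partial>M) < \<infinity>"
    using fin by auto
  have "AE x in M. ?P x + G x = U x + ?N x"
    using eq G by eventually_elim (rule ereal_shift_eq)
  then have "AE x in M. nn_cond_exp M F (\<lambda>x. ?P x + G x) x = nn_cond_exp M F (\<lambda>x. U x + ?N x) x"
    by (intro nn_cond_exp_cong) auto
  moreover have "AE x in M. nn_cond_exp M F ?P x + nn_cond_exp M F G x = nn_cond_exp M F (\<lambda>x. ?P x + G x) x"
    by (intro nn_cond_exp_sum) auto
  moreover have "AE x in M. nn_cond_exp M F U x + nn_cond_exp M F ?N x = nn_cond_exp M F (\<lambda>x. U x + ?N x) x"
    by (intro nn_cond_exp_sum) auto
  moreover have "AE x in M. nn_cond_exp M F G x < \<infinity>" "AE x in M. nn_cond_exp M F ?N x < \<infinity>"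
    by (rule nn_cond_exp_finite; use fin N in simp)+
  ultimately show ?thesis
    unfolding cexp_def
  proof eventually_elim
    case (elim x)
    have *: "enn2ereal p - enn2ereal n = enn2ereal u - enn2ereal g"
      if "p + g = u + n" "g < \<infinity>" "n < \<infinity>" for p g u n
      using that
      by (cases p; cases g; cases u; cases n)
        (auto simp: ennreal_plus[symmetric] algebra_simps simp del: ennreal_plus)
    show ?case
      using elim by (intro *) auto
  qed
qed

lemma cexp_nonneg:
  assumes [measurable]: "X \<in> borel_measurable M" and "AE x in M. 0 \<le> X x"
  shows "AE x in M. 0 \<le> cexp M F X x"
proof -
  have "AE x in M. cexp M F X x
      = enn2ereal (nn_cond_exp M F (\<lambda>x. e2ennreal (X x)) x) - enn2ereal (nn_cond_exp M F (\<lambda>_. 0) x)"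
    using assms(2) by (intro cexp_eq_diff) (auto elim!: eventually_mono simp: enn2ereal_e2ennreal zero_ennreal.rep_eq)
  moreover have "AE x in M. 0 = nn_cond_exp M F (\<lambda>_. 0) x"
    by (intro nn_cond_exp_F_meas) auto
  ultimately show ?thesis
    by eventually_elim (metis enn2ereal_nonneg ereal_minus(7) zero_ennreal.rep_eq)
qed

text \<open>Both sides have the same integral over every set of the sub-sigma-algebra; monotone
  convergence for integrals is applied once before conditioning and once after it.\<close>

lemma nn_cond_exp_monotone_convergence:
  fixes f :: "nat \<Rightarrow> 'a \<Rightarrow> ennreal"
  assumes [measurable]: "\<And>n. f n \<in> borel_measurable M"
    and inc: "\<And>n. AE x in M. f n x \<le> f (Suc n) x"
  shows "AE x in M. (SUP n. nn_cond_exp M F (f n) x) = nn_cond_exp M F (\<lambda>x. SUP n. f n x) x"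
proof (rule nn_cond_exp_charact)
  fix A assume A[measurable]: "A \<in> sets F"
  have [measurable]: "A \<in> sets M"
    using A subalg by (auto simp: subalgebra_def)
  have "(\<integral>\<^sup>+x\<in>A. (SUP n. f n x) \<partial>M) = (\<integral>\<^sup>+x. (SUP n. f n x * indicator A x) \<partial>M)"
    by (simp add: SUP_mult_right_ennreal)
  also have "\<dots> = (SUP n. \<integral>\<^sup>+x. f n x * indicator A x \<partial>M)"
  proof (intro nn_integral_monotone_convergence_SUP_AE)
    fix n
    show "AE x in M. f n x * indicator A x \<le> f (Suc n) x * indicator A x"
      using inc[of n] by eventually_elim (auto intro: mult_right_mono)
  qed auto
  also have "\<dots> = (SUP n. \<integral>\<^sup>+x. nn_cond_exp M F (f n) x * indicator A x \<partial>M)"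
  proof (intro SUP_cong refl)
    fix n
    show "(\<integral>\<^sup>+x. f n x * indicator A x \<partial>M) = (\<integral>\<^sup>+x. nn_cond_exp M F (f n) x * indicator A x \<partial>M)"
      using nn_cond_exp_intg[of "indicator A" "f n"] by (simp add: mult.commute)
  qed
  also have "\<dots> = (\<integral>\<^sup>+x. (SUP n. nn_cond_exp M F (f n) x * indicator A x) \<partial>M)"
  proof (intro nn_integral_monotone_convergence_SUP_AE[symmetric])
    fix n
    have "AE x in M. nn_cond_exp M F (f n) x \<le> nn_cond_exp M F (f (Suc n)) x"
      using inc by (intro nn_cond_exp_mono) auto
    then show "AE x in M. nn_cond_exp M F (f n) x * indicator A x
        \<le> nn_cond_exp M F (f (Suc n)) x * indicator A x"
      by eventually_elim (auto intro: mult_right_mono)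
  qed auto
  finally show "(\<integral>\<^sup>+x\<in>A. (SUP n. f n x) \<partial>M) = (\<integral>\<^sup>+x\<in>A. (SUP n. nn_cond_exp M F (f n) x) \<partial>M)"
    by (simp add: SUP_mult_right_ennreal)
qed auto

text \<open>Shifting by the integrable negative part \<open>G\<close> of the first term makes the
  whole sequence nonnegative. The shift can be removed after conditioning because the conditional
  expectation of \<open>G\<close> is finite almost surely.\<close>

lemma cexp_monotone_convergence:
  fixes X :: "nat \<Rightarrow> 'a \<Rightarrow> ereal"
  assumes [measurable]: "\<And>n. X n \<in> borel_measurable M"
    and inc: "\<And>n. AE x in M. X n x \<le> X (Suc n) x"
    and fin: "(\<integral>\<^sup>+ x. e2ennreal (- X 0 x) \<partial>M) < \<infinity>"
  shows "AE x in M. cexp M F (\<lambda>x. SUP n. X n x) x = (SUP n. cexp M F (X n) x)"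
proof -
  define G where "G x = e2ennreal (- X 0 x)" for x
  define U where "U n x = e2ennreal (X n x + enn2ereal (G x))" for n x
  have [measurable]: "G \<in> borel_measurable M"
    unfolding G_def by measurable
  have [measurable]: "U n \<in> borel_measurable M" for n
    unfolding U_def by measurable
  have fin': "(\<integral>\<^sup>+ x. G x \<partial>M) < \<infinity>"
    using fin by (simp add: G_def)
  have Gfin: "AE x in M. G x < \<infinity>"
    using nn_integral_PInf_AE[of G M] fin' by (auto simp: less_top)
  have inc': "AE x in M. \<forall>n. X n x \<le> X (Suc n) x"
    using inc by (simp add: AE_all_countable)
  have diff: "AE x in M. \<forall>n. X n x = enn2ereal (U n x) - enn2ereal (G x)"
    using inc' Gfin
  proof eventually_elim
    case (elim x)
    show ?case
    proof
      fix n
      have "X 0 x \<le> X n x"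
        using elim(1) by (induction n) (auto intro: order_trans)
      then have "0 \<le> X n x + enn2ereal (G x)"
        unfolding G_def by (cases "X 0 x"; cases "X n x") (auto simp: ennreal.rep_eq max_def)
      then have "enn2ereal (U n x) = X n x + enn2ereal (G x)"
        unfolding U_def by (simp add: enn2ereal_e2ennreal)
      moreover have "\<bar>enn2ereal (G x)\<bar> \<noteq> \<infinity>"
        using elim(2) by (cases "G x") auto
      ultimately show "X n x = enn2ereal (U n x) - enn2ereal (G x)"
        by (cases "enn2ereal (G x)"; cases "X n x") auto
    qed
  qed
  have "AE x in M. (SUP n. X n x) = enn2ereal (SUP n. U n x) - enn2ereal (G x)"
    using diff Gfin by eventually_elim (simp add: SUP_ereal_minus_left enn2ereal_SUP)
  then have 1: "AE x in M. cexp M F (\<lambda>x. SUP n. X n x) x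
      = enn2ereal (nn_cond_exp M F (\<lambda>x. SUP n. U n x) x) - enn2ereal (nn_cond_exp M F G x)"
    using fin' by (intro cexp_eq_diff) auto
  have "AE x in M. cexp M F (X n) x = enn2ereal (nn_cond_exp M F (U n) x) - enn2ereal (nn_cond_exp M F G x)" for n
    using fin' diff by (intro cexp_eq_diff) (auto elim: eventually_mono)
  then have 2: "AE x in M. \<forall>n. cexp M F (X n) x
      = enn2ereal (nn_cond_exp M F (U n) x) - enn2ereal (nn_cond_exp M F G x)"
    by (simp add: AE_all_countable)
  have "AE x in M. U n x \<le> U (Suc n) x" for n
    using inc[of n] by eventually_elim (auto simp: U_def intro!: e2ennreal_mono add_right_mono)
  then have 3: "AE x in M. (SUP n. nn_cond_exp M F (U n) x) = nn_cond_exp M F (\<lambda>x. SUP n. U n x) x"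
    by (intro nn_cond_exp_monotone_convergence) auto
  have 4: "AE x in M. nn_cond_exp M F G x < \<infinity>"
    using fin' by (intro nn_cond_exp_finite) auto
  show ?thesis
    using 1 2 3 4
    by eventually_elim (simp add: SUP_ereal_minus_left flip: enn2ereal_SUP)
qed

text \<open>Makes a second conditioning possible: the negative part of the conditional expectation
  is at most the conditional expectation of the negative part, whose integral is that of the
  negative part itself.\<close>

lemma nn_integral_neg_cexp_finite:
  assumes [measurable]: "X \<in> borel_measurable M" and "(\<integral>\<^sup>+ x. e2ennreal (- X x) \<partial>M) < \<infinity>"
  shows "(\<integral>\<^sup>+ x. e2ennreal (- cexp M F X x) \<partial>M) < \<infinity>"
proof -
  have "(\<integral>\<^sup>+ x. e2ennreal (- cexp M F X x) \<partial>M) \<le> (\<integral>\<^sup>+ x. nn_cond_exp M F (\<lambda>x. e2ennreal (- X x)) x \<partial>M)"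
    unfolding cexp_def by (intro nn_integral_mono e2ennreal_minus_le)
  also have "\<dots> = (\<integral>\<^sup>+ x. e2ennreal (- X x) \<partial>M)"
    by (intro nn_integral_nn_cond_exp) auto
  finally show ?thesis
    using assms(2) by auto
qed

lemma cexp_tower:
  assumes G: "subalgebra M G" "subalgebra G F"
    and [measurable]: "X \<in> borel_measurable M" and fin: "(\<integral>\<^sup>+ x. e2ennreal (- X x) \<partial>M) < \<infinity>"
  shows "AE x in M. cexp M F (cexp M G X) x = cexp M F X x"
proof -
  interpret G: sigma_finite_subalgebra M G
    by (rule nested_subalg_is_sigma_finite[OF G])
  let ?P = "\<lambda>x. e2ennreal (X x)" and ?N = "\<lambda>x. e2ennreal (- X x)"
  \<comment> \<open>The inner difference need not be split into its own positive and negative parts: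
    \<open>cexp_eq_diff\<close> takes the two inner conditional expectations as they are.\<close>
  have "AE x in M. cexp M F (cexp M G X) x
      = enn2ereal (nn_cond_exp M F (nn_cond_exp M G ?P) x) - enn2ereal (nn_cond_exp M F (nn_cond_exp M G ?N) x)"
    using fin by (intro cexp_eq_diff) (auto simp: cexp_def G.nn_integral_nn_cond_exp)
  moreover have "AE x in M. nn_cond_exp M F ?P x = nn_cond_exp M F (nn_cond_exp M G ?P) x"
    "AE x in M. nn_cond_exp M F ?N x = nn_cond_exp M F (nn_cond_exp M G ?N) x"
    using G by (auto intro!: nn_cond_exp_nested_subalg)
  ultimately show ?thesis
    by eventually_elim (simp add: cexp_def)
qed

end

section \<open>Locality of conditional expectations\<close>

text \<open>The two sigma-algebras have the same trace on \<open>A\<close>. Hence the conditional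
  expectation given \<open>F\<close>, cut down to \<open>A\<close>, is \<open>G\<close>-measurable,
  and integrals over \<open>B \<inter> A\<close> can be tested in either sigma-algebra.\<close>

lemma nn_cond_exp_local:
  assumes "sigma_finite_subalgebra M F" "sigma_finite_subalgebra M G"
    and A: "A \<in> sets F" "A \<in> sets G"
    and FG: "\<And>B. B \<in> sets F \<Longrightarrow> B \<inter> A \<in> sets G" and GF: "\<And>B. B \<in> sets G \<Longrightarrow> B \<inter> A \<in> sets F"
    and [measurable]: "f \<in> borel_measurable M" "g \<in> borel_measurable M"
    and eq: "AE x in M. x \<in> A \<longrightarrow> f x = g x"
  shows "AE x in M. x \<in> A \<longrightarrow> nn_cond_exp M F f x = nn_cond_exp M G g x"
proof -
  interpret F: sigma_finite_subalgebra M F by fact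
  interpret G: sigma_finite_subalgebra M G by fact
  note [measurable] = A
  have space: "space F = space M" "space G = space M"
    using F.subalg G.subalg by (auto simp: subalgebra_def)
  have [measurable]: "A \<in> sets M"
    using A F.subalg by (auto simp: subalgebra_def)
  define h where "h x = indicator A x * nn_cond_exp M F f x" for x
  have h: "h \<in> borel_measurable G"
  proof (rule measurableI)
    fix B :: "ennreal set" assume [measurable]: "B \<in> sets borel"
    have "(nn_cond_exp M F f -` B \<inter> space F) \<inter> A \<in> sets G"
      by (intro FG) auto
    \<comment> \<open>Off \<open>A\<close> the function \<open>h\<close> vanishes, so the preimage
      contains either all of the complement of \<open>A\<close> or none of it, according to whether
      0 lies in \<open>B\<close>.\<close>
    moreover have "h -` B \<inter> space G = ((nn_cond_exp M F f -` B \<inter> space F) \<inter> A) \<union>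
        (if 0 \<in> B then space G - A else {})"
      using sets.sets_into_space[OF A(1)] by (auto simp: h_def space split: if_splits split_indicator_asm split_indicator)
    ultimately show "h -` B \<inter> space G \<in> sets G"
      by auto
  qed auto
  have "AE x in M. h x = nn_cond_exp M G (\<lambda>x. indicator A x * f x) x"
  proof (rule G.nn_cond_exp_charact[OF _ _ h])
    fix B assume B: "B \<in> sets G"
    have [measurable]: "B \<inter> A \<in> sets F"
      using GF[OF B] .
    have "(\<integral>\<^sup>+x\<in>B. (indicator A x * f x) \<partial>M) = (\<integral>\<^sup>+x. indicator (B \<inter> A) x * f x \<partial>M)"
      by (intro nn_integral_cong) (auto simp: indicator_def)
    also have "\<dots> = (\<integral>\<^sup>+x. indicator (B \<inter> A) x * nn_cond_exp M F f x \<partial>M)"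
      by (intro F.nn_cond_exp_intg[symmetric]) auto
    also have "\<dots> = (\<integral>\<^sup>+x\<in>B. h x \<partial>M)"
      by (intro nn_integral_cong) (auto simp: indicator_def h_def)
    finally show "(\<integral>\<^sup>+x\<in>B. (indicator A x * f x) \<partial>M) = (\<integral>\<^sup>+x\<in>B. h x \<partial>M)" .
  qed auto
  moreover have "AE x in M. nn_cond_exp M G (\<lambda>x. indicator A x * f x) x
      = nn_cond_exp M G (\<lambda>x. indicator A x * g x) x"
    using eq by (intro G.nn_cond_exp_cong) (auto elim!: eventually_mono simp: indicator_def)
  moreover have "AE x in M. indicator A x * nn_cond_exp M G g x = nn_cond_exp M G (\<lambda>x. indicator A x * g x) x"
    by (intro G.nn_cond_exp_prod) auto
  ultimately show ?thesis
    by eventually_elim (auto simp: h_def)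
qed

lemma cexp_local:
  assumes "sigma_finite_subalgebra M F" "sigma_finite_subalgebra M G"
    and "A \<in> sets F" "A \<in> sets G"
    and "\<And>B. B \<in> sets F \<Longrightarrow> B \<inter> A \<in> sets G" and "\<And>B. B \<in> sets G \<Longrightarrow> B \<inter> A \<in> sets F"
    and [measurable]: "X \<in> borel_measurable M" "Y \<in> borel_measurable M"
    and eq: "AE x in M. x \<in> A \<longrightarrow> X x = Y x"
  shows "AE x in M. x \<in> A \<longrightarrow> cexp M F X x = cexp M G Y x"
proof -
  have "AE x in M. x \<in> A \<longrightarrow>
      nn_cond_exp M F (\<lambda>x. e2ennreal (X x)) x = nn_cond_exp M G (\<lambda>x. e2ennreal (Y x)) x"
    using eq by (intro nn_cond_exp_local assms) (auto elim: eventually_mono)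
  moreover have "AE x in M. x \<in> A \<longrightarrow>
      nn_cond_exp M F (\<lambda>x. e2ennreal (- X x)) x = nn_cond_exp M G (\<lambda>x. e2ennreal (- Y x)) x"
    using eq by (intro nn_cond_exp_local assms) (auto elim: eventually_mono)
  ultimately show ?thesis
    by eventually_elim (auto simp: cexp_def)
qed

section \<open>Stopping times\<close>

locale usual_filtration =
  fixes M :: "'a measure" and F :: "real \<Rightarrow> 'a measure" and T :: real
  assumes setting: "usual_filtered_space M F T"
begin

lemmas setting_conjuncts = setting[unfolded usual_filtered_space_def]

sublocale prob_space M
  using setting_conjuncts[THEN conjunct1] .

lemma T_pos: "0 < T"
  using setting_conjuncts[THEN conjunct2, THEN conjunct1] .

lemma space_F: "t \<in> {0..T} \<Longrightarrow> space (F t) = space M"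
  using setting_conjuncts[THEN conjunct2, THEN conjunct2, THEN conjunct1] by auto

lemma sets_F_mono: "s \<in> {0..T} \<Longrightarrow> t \<in> {0..T} \<Longrightarrow> s \<le> t \<Longrightarrow> A \<in> sets (F s) \<Longrightarrow> A \<in> sets (F t)"
  using setting_conjuncts[THEN conjunct2, THEN conjunct2, THEN conjunct2, THEN conjunct1] by blast

lemma sets_F_T: "sets (F T) = sets M"
  using setting_conjuncts[THEN conjunct2, THEN conjunct2, THEN conjunct2, THEN conjunct2, THEN conjunct1] .

lemma null_subset_sets_F:
  assumes "N \<in> null_sets M" "A \<subseteq> N" "t \<in> {0..T}"
  shows "A \<in> sets (F t)"
proof -
  have "A \<subseteq> space M"
    using assms sets.sets_into_space[of N M] by auto
  then have "A \<in> sets (F 0)"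
    using assms setting_conjuncts[THEN conjunct2, THEN conjunct2, THEN conjunct2, THEN conjunct2,
        THEN conjunct2, THEN conjunct2, THEN conjunct1] by blast
  then show ?thesis
    using assms(3) T_pos by (intro sets_F_mono[of 0 t]) auto
qed

lemma sets_F_AE_cong:
  assumes "A \<in> sets (F t)" "t \<in> {0..T}" "B \<subseteq> space M" "AE \<omega> in M. \<omega> \<in> A \<longleftrightarrow> \<omega> \<in> B"
  shows "B \<in> sets (F t)"
proof -
  obtain N where N: "N \<in> null_sets M" "{\<omega>\<in>space M. \<not> (\<omega> \<in> A \<longleftrightarrow> \<omega> \<in> B)} \<subseteq> N"
    using assms(4) by (auto simp: eventually_ae_filter)
  have A: "A \<subseteq> space M"
    using sets.sets_into_space[OF assms(1)] space_F[OF assms(2)] by simp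
  have "A - B \<in> sets (F t)" "B - A \<in> sets (F t)"
    by (rule null_subset_sets_F[OF N(1)]; use N A assms in auto)+
  then have "(A - (A - B)) \<union> (B - A) \<in> sets (F t)"
    using assms(1) by auto
  moreover have "(A - (A - B)) \<union> (B - A) = B"
    by auto
  ultimately show ?thesis
    by simp
qed

lemma stopT_sets: "stopT M F T \<theta> \<Longrightarrow> t \<in> {0..T} \<Longrightarrow> {\<omega>\<in>space M. \<theta> \<omega> \<le> t} \<in> sets (F t)"
  using stopping_timeD[of F \<theta> t] by (simp add: stopT_def pred_def space_F)

lemma stopT_bounds: "stopT M F T \<theta> \<Longrightarrow> \<omega> \<in> space M \<Longrightarrow> 0 \<le> \<theta> \<omega> \<and> \<theta> \<omega> \<le> T"
  by (auto simp: stopT_def)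

text \<open>The filtration is unconstrained outside the time interval, so its members there may live on
  other spaces; a stopping time that vanishes off the sample space is insensitive to this.\<close>

lemma stopTI:
  assumes sets: "\<And>t. t \<in> {0..T} \<Longrightarrow> {\<omega>\<in>space M. \<theta> \<omega> \<le> t} \<in> sets (F t)"
    and bounds: "\<And>\<omega>. \<omega> \<in> space M \<Longrightarrow> 0 \<le> \<theta> \<omega> \<and> \<theta> \<omega> \<le> T"
    and outside: "\<And>\<omega>. \<omega> \<notin> space M \<Longrightarrow> \<theta> \<omega> = 0"
  shows "stopT M F T \<theta>"
proof -
  have "{\<omega>\<in>space (F t). \<theta> \<omega> \<le> t} \<in> sets (F t)" for t
  proof (cases "t \<in> {0..T}")
    case True
    then show ?thesis
      using sets[OF True] space_F[OF True] by simp
  next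
    case False
    have range: "0 \<le> \<theta> \<omega> \<and> \<theta> \<omega> \<le> T" for \<omega>
      using bounds[of \<omega>] outside[of \<omega>] T_pos by (cases "\<omega> \<in> space M") auto
    have "t < 0 \<or> T < t"
      using False by auto
    then have "(\<forall>\<omega>. \<not> \<theta> \<omega> \<le> t) \<or> (\<forall>\<omega>. \<theta> \<omega> \<le> t)"
      using range by (metis leD less_le_trans linear order_trans less_imp_le)
    then have "{\<omega>\<in>space (F t). \<theta> \<omega> \<le> t} = {} \<or> {\<omega>\<in>space (F t). \<theta> \<omega> \<le> t} = space (F t)"
      by auto
    then show ?thesis
      by (metis sets.empty_sets sets.top)
  qed
  then show ?thesis
    using bounds by (auto simp: stopT_def stopping_time_def pred_def)
qed

lemma stopT_const: "c \<in> {0..T} \<Longrightarrow> stopT M F T (\<lambda>_. c)"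
  by (auto simp: stopT_def stopping_time_const)

lemma stopT_T: "stopT M F T (\<lambda>_. T)"
  using T_pos by (intro stopT_const) auto

text \<open>The generator is already a sigma-algebra. For complements, the part of \<open>A\<close>
  below \<open>t\<close> is removed from {\<theta> \<le> t}, which lies in \<open>F t\<close>
  because \<theta> is a stopping time.\<close>

lemma sets_F_at:
  assumes "stopT M F T \<theta>"
  shows "sets (F_at M F T \<theta>) = {A. A \<in> sets M \<and> (\<forall>t\<in>{0..T}. {\<omega>\<in>A. \<theta> \<omega> \<le> t} \<in> sets (F t))}"
    (is "_ = ?S")
proof -
  have "sigma_algebra (space M) ?S"
    unfolding sigma_algebra_iff2
  proof (intro conjI ballI allI impI CollectI)
    show "?S \<subseteq> Pow (space M)"
      using sets.sets_into_space by auto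
  next
    fix A t assume A: "A \<in> ?S" and t: "t \<in> {0..T}"
    then have "{\<omega>\<in>space M. \<theta> \<omega> \<le> t} - {\<omega>\<in>A. \<theta> \<omega> \<le> t} \<in> sets (F t)"
      using stopT_sets[OF assms t] by auto
    moreover have "{\<omega>\<in>space M. \<theta> \<omega> \<le> t} - {\<omega>\<in>A. \<theta> \<omega> \<le> t} = {\<omega>\<in>space M - A. \<theta> \<omega> \<le> t}"
      by auto
    ultimately show "{\<omega>\<in>space M - A. \<theta> \<omega> \<le> t} \<in> sets (F t)"
      by simp
  next
    fix A :: "nat \<Rightarrow> 'a set" and t assume A: "range A \<subseteq> ?S" and t: "t \<in> {0..T}"
    then have "(\<Union>i. {\<omega>\<in>A i. \<theta> \<omega> \<le> t}) \<in> sets (F t)"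
      by (intro sets.countable_UN) auto
    moreover have "(\<Union>i. {\<omega>\<in>A i. \<theta> \<omega> \<le> t}) = {\<omega>\<in>(\<Union>i. A i). \<theta> \<omega> \<le> t}"
      by auto
    ultimately show "{\<omega>\<in>(\<Union>i. A i). \<theta> \<omega> \<le> t} \<in> sets (F t)"
      by simp
  qed auto
  then show ?thesis
    unfolding F_at_def by (rule sigma_algebra.sets_measure_of_eq)
qed

lemma subalgebra_F_at:
  assumes "stopT M F T \<theta>"
  shows "subalgebra M (F_at M F T \<theta>)"
proof -
  have "space (F_at M F T \<theta>) = space M"
    unfolding F_at_def using sets.sets_into_space by (intro space_measure_of) auto
  then show ?thesis
    using sets_F_at[OF assms] by (auto simp: subalgebra_def)
qed

lemma sigma_finite_F_at:
  assumes "stopT M F T \<theta>"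
  shows "sigma_finite_subalgebra M (F_at M F T \<theta>)"
  using subalgebra_F_at[OF assms] finite_measure_axioms
  by (intro finite_measure_subalgebra_is_sigma_finite)
    (auto simp: finite_measure_subalgebra_def finite_measure_subalgebra_axioms_def)

text \<open>Cutting {\<theta>' \<le> t} down by {\<theta> \<le> t} leaves {\<theta> \<le> t} up to a
  null set, since the order holds only almost surely; completeness absorbs the difference.\<close>

lemma F_at_mono:
  assumes \<theta>: "stopT M F T \<theta>" and \<theta>': "stopT M F T \<theta>'" and le: "AE \<omega> in M. \<theta>' \<omega> \<le> \<theta> \<omega>"
    and A: "A \<in> sets (F_at M F T \<theta>')"
  shows "A \<in> sets (F_at M F T \<theta>)"
proof -
  have A': "A \<in> sets M" "\<And>t. t \<in> {0..T} \<Longrightarrow> {\<omega>\<in>A. \<theta>' \<omega> \<le> t} \<in> sets (F t)"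
    using A sets_F_at[OF \<theta>'] by auto
  have "{\<omega>\<in>A. \<theta> \<omega> \<le> t} \<in> sets (F t)" if t: "t \<in> {0..T}" for t
  proof (rule sets_F_AE_cong[OF _ t])
    show "{\<omega>\<in>A. \<theta>' \<omega> \<le> t} \<inter> {\<omega>\<in>space M. \<theta> \<omega> \<le> t} \<in> sets (F t)"
      using A'(2)[OF t] stopT_sets[OF \<theta> t] by auto
    show "{\<omega>\<in>A. \<theta> \<omega> \<le> t} \<subseteq> space M"
      using sets.sets_into_space[OF A'(1)] by auto
    show "AE \<omega> in M. \<omega> \<in> {\<omega>\<in>A. \<theta>' \<omega> \<le> t} \<inter> {\<omega>\<in>space M. \<theta> \<omega> \<le> t} \<longleftrightarrow> \<omega> \<in> {\<omega>\<in>A. \<theta> \<omega> \<le> t}"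
      using le AE_space by eventually_elim auto
  qed
  then show ?thesis
    using A'(1) sets_F_at[OF \<theta>] by auto
qed

lemma subalgebra_F_at_mono:
  assumes "stopT M F T \<theta>" "stopT M F T \<theta>'" "AE \<omega> in M. \<theta>' \<omega> \<le> \<theta> \<omega>"
  shows "subalgebra (F_at M F T \<theta>) (F_at M F T \<theta>')"
  using subalgebra_F_at[OF assms(1)] subalgebra_F_at[OF assms(2)] F_at_mono[OF assms]
  by (auto simp: subalgebra_def)

text \<open>The value 0 off the sample space makes \<open>stopTI\<close> applicable.\<close>

definition paste :: "'a set \<Rightarrow> ('a \<Rightarrow> real) \<Rightarrow> ('a \<Rightarrow> real) \<Rightarrow> 'a \<Rightarrow> real" where
  "paste A \<tau> \<sigma> \<omega> = (if \<omega> \<in> space M then if \<omega> \<in> A then \<tau> \<omega> else \<sigma> \<omega> else 0)"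

lemma stopT_paste:
  assumes S: "stopT M F T S" and A: "A \<in> sets (F_at M F T S)"
    and \<tau>: "\<tau> \<in> stopT_from M F T S" and \<sigma>: "\<sigma> \<in> stopT_from M F T S"
  shows "stopT M F T (paste A \<tau> \<sigma>)"
proof (rule stopTI)
  have st: "stopT M F T \<tau>" "stopT M F T \<sigma>" and le: "AE \<omega> in M. S \<omega> \<le> \<tau> \<omega>" "AE \<omega> in M. S \<omega> \<le> \<sigma> \<omega>"
    using \<tau> \<sigma> by (auto simp: stopT_from_def)
  \<comment> \<open>The event is known at time \<open>S\<close>, hence at both later times, so each
    branch can be tested in its own sigma-algebra.\<close>
  have A1: "A \<in> sets (F_at M F T \<tau>)" and A2: "A \<in> sets (F_at M F T \<sigma>)"
    using F_at_mono[OF _ S _ A] st le by auto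
  show "{\<omega>\<in>space M. paste A \<tau> \<sigma> \<omega> \<le> t} \<in> sets (F t)" if t: "t \<in> {0..T}" for t
  proof -
    have "{\<omega>\<in>A. \<tau> \<omega> \<le> t} \<union> ({\<omega>\<in>space M. \<sigma> \<omega> \<le> t} - {\<omega>\<in>A. \<sigma> \<omega> \<le> t}) \<in> sets (F t)"
      using A1 A2 t stopT_sets[OF st(2) t] by (auto simp: sets_F_at st)
    moreover have "A \<subseteq> space M"
      using A sets.sets_into_space[of A M] by (auto simp: sets_F_at S)
    then have "{\<omega>\<in>A. \<tau> \<omega> \<le> t} \<union> ({\<omega>\<in>space M. \<sigma> \<omega> \<le> t} - {\<omega>\<in>A. \<sigma> \<omega> \<le> t})
        = {\<omega>\<in>space M. paste A \<tau> \<sigma> \<omega> \<le> t}"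
      by (auto simp: paste_def)
    ultimately show ?thesis
      by simp
  qed
  show "0 \<le> paste A \<tau> \<sigma> \<omega> \<and> paste A \<tau> \<sigma> \<omega> \<le> T" if "\<omega> \<in> space M" for \<omega>
    using stopT_bounds[OF st(1) that] stopT_bounds[OF st(2) that] by (auto simp: paste_def)
qed (simp add: paste_def)

text \<open>Truncation at \<open>t\<close> hides the values still unknown at that time: level sets
  below \<open>t\<close> come from earlier sigma-algebras, and from \<open>t\<close> on they are the
  whole space.\<close>

lemma stopT_measurable_min:
  assumes "stopT M F T \<theta>" and t: "t \<in> {0..T}"
  shows "(\<lambda>\<omega>. min (\<theta> \<omega>) t) \<in> borel_measurable (F t)"
proof (rule borel_measurableI_le)
  fix s
  show "{\<omega>\<in>space (F t). min (\<theta> \<omega>) t \<le> s} \<in> sets (F t)"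
  proof (cases "s < t")
    case True
    show ?thesis
    proof (cases "0 \<le> s")
      case True
      then have "{\<omega>\<in>space M. \<theta> \<omega> \<le> s} \<in> sets (F t)"
        using \<open>s < t\<close> t by (intro sets_F_mono[OF _ t _ stopT_sets[OF assms(1)]]) auto
      moreover have "{\<omega>\<in>space M. \<theta> \<omega> \<le> s} = {\<omega>\<in>space (F t). min (\<theta> \<omega>) t \<le> s}"
        using space_F[OF t] \<open>s < t\<close> by auto
      ultimately show ?thesis
        by simp
    next
      case False
      then have "{\<omega>\<in>space (F t). min (\<theta> \<omega>) t \<le> s} = {}"
        using stopT_bounds[OF assms(1)] t by (force simp: space_F[OF t])
      then show ?thesis
        by (metis sets.empty_sets)
    qed
  next
    case False
    then have "{\<omega>\<in>space (F t). min (\<theta> \<omega>) t \<le> s} = space (F t)"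
      by auto
    then show ?thesis
      by (metis sets.top)
  qed
qed

lemma sets_F_at_eq:
  assumes \<theta>: "stopT M F T \<theta>" and \<theta>': "stopT M F T \<theta>'"
  shows "{\<omega>\<in>space M. \<theta> \<omega> = \<theta>' \<omega>} \<in> sets (F_at M F T \<theta>)"
proof -
  let ?A = "{\<omega>\<in>space M. \<theta> \<omega> = \<theta>' \<omega>}"
  have *: "{\<omega>\<in>?A. \<theta> \<omega> \<le> t} \<in> sets (F t)" if t: "t \<in> {0..T}" for t
  proof -
    \<comment> \<open>Once both times are at most \<open>t\<close>, their equality is that of their
      truncations at \<open>t\<close>, which is decided by time \<open>t\<close>.\<close>
    have "{\<omega>\<in>space (F t). min (\<theta> \<omega>) t = min (\<theta>' \<omega>) t} \<inter> {\<omega>\<in>space M. \<theta> \<omega> \<le> t} \<inter> {\<omega>\<in>space M. \<theta>' \<omega> \<le> t}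
        \<in> sets (F t)"
      by (rule sets.Int[OF sets.Int[OF borel_measurable_eq[OF stopT_measurable_min[OF \<theta> t]
                stopT_measurable_min[OF \<theta>' t]] stopT_sets[OF \<theta> t]] stopT_sets[OF \<theta>' t]])
    moreover have "{\<omega>\<in>space (F t). min (\<theta> \<omega>) t = min (\<theta>' \<omega>) t} \<inter> {\<omega>\<in>space M. \<theta> \<omega> \<le> t} \<inter> {\<omega>\<in>space M. \<theta>' \<omega> \<le> t}
        = {\<omega>\<in>?A. \<theta> \<omega> \<le> t}"
      unfolding space_F[OF t] by (auto simp: min_def)
    ultimately show ?thesis
      by simp
  qed
  have "{\<omega>\<in>?A. \<theta> \<omega> \<le> T} = ?A"
    using stopT_bounds[OF \<theta>] by auto
  then have "?A \<in> sets M"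
    using *[of T] T_pos sets_F_T by simp
  then show ?thesis
    using * by (simp add: sets_F_at \<theta>)
qed

text \<open>On {\<theta> = \<theta>'} the defining conditions of the two sigma-algebras are the
  same. Applied in both directions, this yields the trace hypotheses of
  \<open>cexp_local\<close>.\<close>

lemma sets_F_at_trace:
  assumes \<theta>: "stopT M F T \<theta>" and \<theta>': "stopT M F T \<theta>'" and B: "B \<in> sets (F_at M F T \<theta>)"
  shows "B \<inter> {\<omega>\<in>space M. \<theta> \<omega> = \<theta>' \<omega>} \<in> sets (F_at M F T \<theta>')"
proof -
  let ?A = "{\<omega>\<in>space M. \<theta> \<omega> = \<theta>' \<omega>}"
  have "B \<inter> ?A \<in> sets (F_at M F T \<theta>)"
    using B sets_F_at_eq[OF \<theta> \<theta>'] by auto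
  moreover have "{\<omega>\<in>B \<inter> ?A. \<theta> \<omega> \<le> t} = {\<omega>\<in>B \<inter> ?A. \<theta>' \<omega> \<le> t}" for t
    by auto
  ultimately show ?thesis
    by (simp add: sets_F_at \<theta> \<theta>')
qed

section \<open>Admissible families\<close>

lemma admissible_measurable:
  "admissible M F T \<phi> \<Longrightarrow> stopT M F T \<theta> \<Longrightarrow> \<phi> \<theta> \<in> borel_measurable (F_at M F T \<theta>)"
  by (simp add: admissible_def)

lemma admissible_measurable2:
  "admissible M F T \<phi> \<Longrightarrow> stopT M F T \<theta> \<Longrightarrow> \<phi> \<theta> \<in> borel_measurable M"
  by (rule measurable_from_subalg[OF subalgebra_F_at admissible_measurable])

lemma admissible_AE_eq:
  "admissible M F T \<phi> \<Longrightarrow> stopT M F T \<theta> \<Longrightarrow> stopT M F T \<theta>' \<Longrightarrow>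
    AE \<omega> in M. \<theta> \<omega> = \<theta>' \<omega> \<longrightarrow> \<phi> \<theta> \<omega> = \<phi> \<theta>' \<omega>"
  by (simp add: admissible_def)

text \<open>For admissible families this is weaker than \<open>int_esssup\<close> of the negative
  parts, as it treats one stopping time at a time. Conditional monotone convergence asks no more,
  and no essential supremum has to be estimated when families are added.\<close>

definition lower_integrable :: "'a family \<Rightarrow> bool" where
  "lower_integrable \<phi> \<longleftrightarrow> (\<forall>\<theta>. stopT M F T \<theta> \<longrightarrow> (\<integral>\<^sup>+ \<omega>. e2ennreal (- \<phi> \<theta> \<omega>) \<partial>M) < \<infinity>)"

lemma paste_in_stopT_from:
  assumes S: "stopT M F T S" and A: "A \<in> sets (F_at M F T S)"
    and \<tau>: "\<tau> \<in> stopT_from M F T S" and \<sigma>: "\<sigma> \<in> stopT_from M F T S"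
  shows "paste A \<tau> \<sigma> \<in> stopT_from M F T S"
proof -
  have "AE \<omega> in M. S \<omega> \<le> \<tau> \<omega>" "AE \<omega> in M. S \<omega> \<le> \<sigma> \<omega>"
    using \<tau> \<sigma> by (auto simp: stopT_from_def)
  with AE_space have "AE \<omega> in M. S \<omega> \<le> paste A \<tau> \<sigma> \<omega>"
    by eventually_elim (auto simp: paste_def)
  then show ?thesis
    using stopT_paste[OF assms] by (simp add: stopT_from_def)
qed

lemma T_in_stopT_from: "stopT M F T S \<Longrightarrow> (\<lambda>_. T) \<in> stopT_from M F T S"
  using stopT_T stopT_bounds by (auto simp: stopT_from_def intro!: AE_I2)

text \<open>Has two uses: varying the conditioning time gives admissibility of Snell envelopes, and
  varying only the rewarded stopping time evaluates pasted times.\<close>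

lemma cexp_F_at_eq:
  assumes \<phi>: "admissible M F T \<phi>" and \<theta>: "stopT M F T \<theta>" "stopT M F T \<theta>'"
    and \<tau>: "stopT M F T \<tau>" "stopT M F T \<tau>'"
    and A: "A \<in> sets (F_at M F T \<theta>)" and sub: "\<And>\<omega>. \<omega> \<in> A \<Longrightarrow> \<theta> \<omega> = \<theta>' \<omega>"
    and eq: "\<And>\<omega>. \<omega> \<in> A \<Longrightarrow> \<tau> \<omega> = \<tau>' \<omega>"
  shows "AE \<omega> in M. \<omega> \<in> A \<longrightarrow> cexp M (F_at M F T \<theta>) (\<phi> \<tau>) \<omega> = cexp M (F_at M F T \<theta>') (\<phi> \<tau>') \<omega>"
proof -
  let ?E = "{\<omega>\<in>space M. \<theta> \<omega> = \<theta>' \<omega>}"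
  have "A \<subseteq> space M"
    using A sets.sets_into_space[of A M] by (auto simp: sets_F_at \<theta>)
  then have AE: "B \<inter> A = (B \<inter> A) \<inter> ?E" for B
    using sub by auto
  have E: "?E = {\<omega>\<in>space M. \<theta>' \<omega> = \<theta> \<omega>}"
    by auto
  have A': "A \<in> sets (F_at M F T \<theta>')"
    using sets_F_at_trace[OF \<theta> A] AE[of A] by simp
  show ?thesis
  proof (rule cexp_local[OF _ _ A A'])
    show "B \<inter> A \<in> sets (F_at M F T \<theta>')" if "B \<in> sets (F_at M F T \<theta>)" for B
      using sets_F_at_trace[OF \<theta>, of "B \<inter> A"] that A AE[of B] by simp
    show "B \<inter> A \<in> sets (F_at M F T \<theta>)" if "B \<in> sets (F_at M F T \<theta>')" for B
      using sets_F_at_trace[OF \<theta>(2,1), of "B \<inter> A"] that A' AE[of B] E by simp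
    show "AE \<omega> in M. \<omega> \<in> A \<longrightarrow> \<phi> \<tau> \<omega> = \<phi> \<tau>' \<omega>"
      using admissible_AE_eq[OF \<phi> \<tau>] eq by (auto elim!: eventually_mono)
  qed (use sigma_finite_F_at \<theta> admissible_measurable2[OF \<phi>] \<tau> in auto)
qed

section \<open>Snell envelopes\<close>

lemma cexp_F_at_measurable:
  "stopT M F T S \<Longrightarrow> cexp M (F_at M F T S) X \<in> borel_measurable (F_at M F T S)"
  by (rule sigma_finite_subalgebra.cexp_measurable[OF sigma_finite_F_at])

lemma snell_measurable:
  assumes "stopT M F T S"
  shows "snell M F T \<phi> S \<in> borel_measurable (F_at M F T S)"
  unfolding snell_def by (intro ess_sup_fam_measurable subalgebra_F_at cexp_F_at_measurable assms)

lemma snell_upper: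
  assumes "stopT M F T S" "\<tau> \<in> stopT_from M F T S"
  shows "AE \<omega> in M. cexp M (F_at M F T S) (\<phi> \<tau>) \<omega> \<le> snell M F T \<phi> S \<omega>"
  unfolding snell_def
  by (rule ess_sup_fam_upper[where X="\<lambda>\<theta>. cexp M (F_at M F T S) (\<phi> \<theta>)",
        OF subalgebra_F_at[OF assms(1)] cexp_F_at_measurable[OF assms(1)] assms(2)])

lemma snell_least:
  assumes "stopT M F T S" "Z \<in> borel_measurable M"
    and "\<And>\<tau>. \<tau> \<in> stopT_from M F T S \<Longrightarrow> AE \<omega> in M. cexp M (F_at M F T S) (\<phi> \<tau>) \<omega> \<le> Z \<omega>"
  shows "AE \<omega> in M. snell M F T \<phi> S \<omega> \<le> Z \<omega>"
  unfolding snell_def by (intro ess_sup_fam_least subalgebra_F_at cexp_F_at_measurable assms)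

context
  fixes \<phi> :: "'a family"
  assumes \<phi>: "admissible M F T \<phi>"
begin

text \<open>A competitor \<tau> after \<theta> need not come after \<theta>'. Replacing it by
  \<open>T\<close> off {\<theta> = \<theta>'} repairs this, and locality keeps its conditional
  reward unchanged on that event.\<close>

lemma snell_le_on_eq:
  assumes \<theta>: "stopT M F T \<theta>" "stopT M F T \<theta>'"
  shows "AE \<omega> in M. \<theta> \<omega> = \<theta>' \<omega> \<longrightarrow> snell M F T \<phi> \<theta> \<omega> \<le> snell M F T \<phi> \<theta>' \<omega>"
proof -
  define A where "A = {\<omega>\<in>space M. \<theta> \<omega> = \<theta>' \<omega>}"
  \<comment> \<open>The value \<infinity> off \<open>A\<close> localises the inequality, because
    \<open>snell_least\<close> asks for a bound valid almost everywhere.\<close>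
  define Z where "Z \<omega> = (if \<omega> \<in> A then snell M F T \<phi> \<theta>' \<omega> else \<infinity>)" for \<omega>
  have A: "A \<in> sets (F_at M F T \<theta>)"
    unfolding A_def by (rule sets_F_at_eq[OF \<theta>])
  have A': "A \<in> sets (F_at M F T \<theta>')"
    using sets_F_at_trace[OF \<theta> A] by (simp add: A_def)
  have [measurable]: "A \<in> sets M" "snell M F T \<phi> \<theta>' \<in> borel_measurable M"
    using A \<theta> measurable_from_subalg[OF subalgebra_F_at snell_measurable] by (auto simp: sets_F_at)
  have "AE \<omega> in M. snell M F T \<phi> \<theta> \<omega> \<le> Z \<omega>"
  proof (rule snell_least[OF \<theta>(1)])
    show "Z \<in> borel_measurable M"
      unfolding Z_def by measurable
    fix \<tau> assume "\<tau> \<in> stopT_from M F T \<theta>"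
    then have \<tau>: "stopT M F T \<tau>" "AE \<omega> in M. \<theta> \<omega> \<le> \<tau> \<omega>"
      by (auto simp: stopT_from_def)
    define \<rho> where "\<rho> = paste A \<tau> (\<lambda>_. T)"
    have \<rho>: "stopT M F T \<rho>"
      unfolding \<rho>_def
      using stopT_paste[OF \<theta>(1) A \<open>\<tau> \<in> stopT_from M F T \<theta>\<close> T_in_stopT_from[OF \<theta>(1)]] .
    have "AE \<omega> in M. \<theta>' \<omega> \<le> \<rho> \<omega>"
      using \<tau>(2) AE_space by eventually_elim (auto simp: \<rho>_def paste_def A_def stopT_bounds[OF \<theta>(2)])
    then have "AE \<omega> in M. cexp M (F_at M F T \<theta>') (\<phi> \<rho>) \<omega> \<le> snell M F T \<phi> \<theta>' \<omega>"
      using \<rho> \<theta> by (intro snell_upper) (auto simp: stopT_from_def)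
    moreover have "AE \<omega> in M. \<omega> \<in> A \<longrightarrow>
        cexp M (F_at M F T \<theta>) (\<phi> \<tau>) \<omega> = cexp M (F_at M F T \<theta>') (\<phi> \<rho>) \<omega>"
      by (rule cexp_F_at_eq[OF \<phi> \<theta> \<tau>(1) \<rho> A]) (auto simp: A_def \<rho>_def paste_def)
    ultimately show "AE \<omega> in M. cexp M (F_at M F T \<theta>) (\<phi> \<tau>) \<omega> \<le> Z \<omega>"
      by eventually_elim (auto simp: Z_def)
  qed
  then show ?thesis
    using AE_space by eventually_elim (auto simp: Z_def A_def)
qed

lemma admissible_snell: "admissible M F T (snell M F T \<phi>)"
  unfolding admissible_def
proof (intro conjI allI impI)
  fix \<theta> \<theta>' assume "stopT M F T \<theta>" "stopT M F T \<theta>'"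
  then show "AE \<omega> in M. \<theta> \<omega> = \<theta>' \<omega> \<longrightarrow> snell M F T \<phi> \<theta> \<omega> = snell M F T \<phi> \<theta>' \<omega>"
    using snell_le_on_eq[of \<theta> \<theta>'] snell_le_on_eq[of \<theta>' \<theta>]
    by (auto elim!: eventually_elim2)
qed (rule snell_measurable)

text \<open>Follow \<tau> where its conditional reward is at least that of \<sigma>, and \<sigma>
  elsewhere. The selecting event is known at time \<open>S\<close>, so the pasted time attains the
  maximum of both rewards.\<close>

lemma snell_directed:
  assumes S: "stopT M F T S" and \<tau>: "\<tau> \<in> stopT_from M F T S" and \<sigma>: "\<sigma> \<in> stopT_from M F T S"
  shows "\<exists>\<rho>\<in>stopT_from M F T S.
    (AE \<omega> in M. cexp M (F_at M F T S) (\<phi> \<tau>) \<omega> \<le> cexp M (F_at M F T S) (\<phi> \<rho>) \<omega>) \<and>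
    (AE \<omega> in M. cexp M (F_at M F T S) (\<phi> \<sigma>) \<omega> \<le> cexp M (F_at M F T S) (\<phi> \<rho>) \<omega>)"
proof -
  let ?N = "F_at M F T S"
  have space: "space ?N = space M"
    using subalgebra_F_at[OF S] by (simp add: subalgebra_def)
  note [measurable] = cexp_F_at_measurable[OF S]
  define A where "A = {\<omega>\<in>space ?N. cexp M ?N (\<phi> \<sigma>) \<omega> \<le> cexp M ?N (\<phi> \<tau>) \<omega>}"
  have A: "A \<in> sets ?N"
    unfolding A_def by measurable
  define \<rho> where "\<rho> = paste A \<tau> \<sigma>"
  have \<rho>: "\<rho> \<in> stopT_from M F T S"
    unfolding \<rho>_def by (rule paste_in_stopT_from[OF S A \<tau> \<sigma>])
  have st: "stopT M F T \<tau>" "stopT M F T \<sigma>" "stopT M F T \<rho>"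
    using \<tau> \<sigma> \<rho> by (auto simp: stopT_from_def)
  have "AE \<omega> in M. \<omega> \<in> A \<longrightarrow> cexp M ?N (\<phi> \<rho>) \<omega> = cexp M ?N (\<phi> \<tau>) \<omega>"
    by (rule cexp_F_at_eq[OF \<phi> S S st(3,1) A]) (auto simp: \<rho>_def paste_def A_def space)
  moreover have "AE \<omega> in M. \<omega> \<in> space ?N - A \<longrightarrow> cexp M ?N (\<phi> \<rho>) \<omega> = cexp M ?N (\<phi> \<sigma>) \<omega>"
    by (rule cexp_F_at_eq[OF \<phi> S S st(3,2) sets.compl_sets[OF A]]) (auto simp: \<rho>_def paste_def space)
  ultimately have "AE \<omega> in M. cexp M ?N (\<phi> \<tau>) \<omega> \<le> cexp M ?N (\<phi> \<rho>) \<omega> \<and>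
      cexp M ?N (\<phi> \<sigma>) \<omega> \<le> cexp M ?N (\<phi> \<rho>) \<omega>"
    using AE_space by eventually_elim (auto simp: A_def space)
  then show ?thesis
    using \<rho> by (intro bexI[of _ \<rho>]) (auto elim: eventually_mono)
qed

lemma snell_supermartingale:
  assumes li: "lower_integrable \<phi>" and \<theta>: "stopT M F T \<theta>" "stopT M F T \<theta>'"
    and le: "AE \<omega> in M. \<theta>' \<omega> \<le> \<theta> \<omega>"
  shows "AE \<omega> in M. cexp M (F_at M F T \<theta>') (snell M F T \<phi> \<theta>) \<omega> \<le> snell M F T \<phi> \<theta>' \<omega>"
proof -
  let ?N = "F_at M F T \<theta>" and ?N' = "F_at M F T \<theta>'"
  interpret N: sigma_finite_subalgebra M ?N
    by (rule sigma_finite_F_at[OF \<theta>(1)])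
  interpret N': sigma_finite_subalgebra M ?N'
    by (rule sigma_finite_F_at[OF \<theta>(2)])
  have ne: "stopT_from M F T \<theta> \<noteq> {}"
    using T_in_stopT_from[OF \<theta>(1)] by auto
  obtain s where s: "\<And>n. s n \<in> stopT_from M F T \<theta>"
    "\<And>n. AE \<omega> in M. cexp M ?N (\<phi> (s n)) \<omega> \<le> cexp M ?N (\<phi> (s (Suc n))) \<omega>"
    "AE \<omega> in M. snell M F T \<phi> \<theta> \<omega> = (SUP n. cexp M ?N (\<phi> (s n)) \<omega>)"
    using ess_sup_fam_directed[where I="stopT_from M F T \<theta>" and X="\<lambda>\<tau>. cexp M ?N (\<phi> \<tau>)",
        OF subalgebra_F_at[OF \<theta>(1)] N.cexp_measurable ne snell_directed[OF \<theta>(1)]]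
    unfolding snell_def by blast
  have st: "stopT M F T (s n)" for n
    using s(1) by (auto simp: stopT_from_def)
  have meas[measurable]: "\<phi> (s n) \<in> borel_measurable M" for n
    using admissible_measurable2[OF \<phi> st] .
  have fin: "(\<integral>\<^sup>+ \<omega>. e2ennreal (- \<phi> (s n) \<omega>) \<partial>M) < \<infinity>" for n
    using li st by (simp add: lower_integrable_def)
  \<comment> \<open>Competitors after \<theta> are also competitors after \<theta>'; by the tower
    property their rewards, conditioned twice, stay below the envelope at \<theta>'.\<close>
  have s': "s n \<in> stopT_from M F T \<theta>'" for n
  proof -
    have "AE \<omega> in M. \<theta> \<omega> \<le> s n \<omega>"
      using s(1) by (auto simp: stopT_from_def)
    with le have "AE \<omega> in M. \<theta>' \<omega> \<le> s n \<omega>"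
      by eventually_elim auto
    then show ?thesis
      using st by (simp add: stopT_from_def)
  qed
  have "AE \<omega> in M. cexp M ?N' (snell M F T \<phi> \<theta>) \<omega> = cexp M ?N' (\<lambda>\<omega>. SUP n. cexp M ?N (\<phi> (s n)) \<omega>) \<omega>"
    using s(3) measurable_from_subalg[OF subalgebra_F_at[OF \<theta>(1)] snell_measurable[OF \<theta>(1)]]
    by (intro N'.cexp_cong_AE) auto
  moreover have "AE \<omega> in M. cexp M ?N' (\<lambda>\<omega>. SUP n. cexp M ?N (\<phi> (s n)) \<omega>) \<omega>
      = (SUP n. cexp M ?N' (cexp M ?N (\<phi> (s n))) \<omega>)"
    using s(2) N.nn_integral_neg_cexp_finite[OF meas fin]
    by (intro N'.cexp_monotone_convergence) auto
  moreover have "AE \<omega> in M. \<forall>n. cexp M ?N' (cexp M ?N (\<phi> (s n))) \<omega> = cexp M ?N' (\<phi> (s n)) \<omega>"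
    unfolding AE_all_countable
    using N'.cexp_tower[OF subalgebra_F_at[OF \<theta>(1)] subalgebra_F_at_mono[OF \<theta> le] meas fin] by auto
  moreover have "AE \<omega> in M. \<forall>n. cexp M ?N' (\<phi> (s n)) \<omega> \<le> snell M F T \<phi> \<theta>' \<omega>"
    unfolding AE_all_countable using snell_upper[OF \<theta>(2) s'] by auto
  ultimately show ?thesis
    by eventually_elim (auto intro: SUP_least)
qed

end

section \<open>Integrability and order of families\<close>

lemma lower_integrable_if_int_esssup:
  assumes \<phi>: "admissible M F T \<phi>" and int: "int_esssup M F T negpart \<phi>"
  shows "lower_integrable \<phi>"
  unfolding lower_integrable_def
proof (intro allI impI)
  fix \<theta> assume \<theta>: "stopT M F T \<theta>"
  let ?Y = "ess_sup_fam M M {\<theta>. stopT M F T \<theta>} (\<lambda>\<theta> x. negpart (\<phi> \<theta> x))"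
  have "AE \<omega> in M. negpart (\<phi> \<theta> \<omega>) \<le> ?Y \<omega>"
  proof (rule ess_sup_fam_upper[where X="\<lambda>\<theta> x. negpart (\<phi> \<theta> x)"])
    fix \<tau> assume "\<tau> \<in> {\<theta>. stopT M F T \<theta>}"
    then have [measurable]: "\<phi> \<tau> \<in> borel_measurable M"
      by (simp add: admissible_measurable2[OF \<phi>])
    show "(\<lambda>x. negpart (\<phi> \<tau> x)) \<in> borel_measurable M"
      unfolding negpart_def by measurable
  qed (use \<theta> in \<open>simp_all add: subalgebra_def\<close>)
  then have "(\<integral>\<^sup>+ \<omega>. e2ennreal (- \<phi> \<theta> \<omega>) \<partial>M) \<le> (\<integral>\<^sup>+ \<omega>. e2ennreal (?Y \<omega>) \<partial>M)"
    by (intro nn_integral_mono_AE, elim eventually_mono) (intro e2ennreal_mono, simp add: negpart_def)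
  also have "\<dots> < \<infinity>"
    using int by (simp add: int_esssup_def)
  finally show "(\<integral>\<^sup>+ \<omega>. e2ennreal (- \<phi> \<theta> \<omega>) \<partial>M) < \<infinity>" .
qed

text \<open>All negative parts vanish almost surely, so 0 bounds their essential supremum. The sign
  of J and J' alone thus settles the integrability clause of
  \<open>supermart_family\<close>.\<close>

lemma int_esssup_negpart_nonneg:
  assumes \<phi>: "admissible M F T \<phi>" and nonneg: "fam_le M F T (\<lambda>\<theta> \<omega>. 0) \<phi>"
  shows "int_esssup M F T negpart \<phi>"
proof -
  let ?Y = "ess_sup_fam M M {\<theta>. stopT M F T \<theta>} (\<lambda>\<theta> x. negpart (\<phi> \<theta> x))"
  have "AE \<omega> in M. ?Y \<omega> \<le> 0"
  proof (rule ess_sup_fam_least)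
    fix \<theta> assume "\<theta> \<in> {\<theta>. stopT M F T \<theta>}"
    then have \<theta>: "stopT M F T \<theta>"
      by simp
    note [measurable] = admissible_measurable2[OF \<phi> \<theta>]
    show "(\<lambda>x. negpart (\<phi> \<theta> x)) \<in> borel_measurable M"
      unfolding negpart_def by measurable
    have "AE \<omega> in M. 0 \<le> \<phi> \<theta> \<omega>"
      using nonneg \<theta> by (simp add: fam_le_def)
    then show "AE \<omega> in M. negpart (\<phi> \<theta> \<omega>) \<le> 0"
      by eventually_elim (simp add: negpart_def)
  qed (simp_all add: subalgebra_def)
  then have "(\<integral>\<^sup>+ \<omega>. e2ennreal (?Y \<omega>) \<partial>M) \<le> (\<integral>\<^sup>+ \<omega>. 0 \<partial>M)"
    by (intro nn_integral_mono_AE) (auto elim!: eventually_mono simp: e2ennreal_neg)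
  then show ?thesis
    by (simp add: int_esssup_def)
qed

lemma admissible_add:
  assumes "admissible M F T \<phi>" "admissible M F T \<psi>"
  shows "admissible M F T (\<lambda>\<theta> \<omega>. \<phi> \<theta> \<omega> + \<psi> \<theta> \<omega>)"
  unfolding admissible_def
proof (intro conjI allI impI)
  fix \<theta> assume "stopT M F T \<theta>"
  then show "(\<lambda>\<omega>. \<phi> \<theta> \<omega> + \<psi> \<theta> \<omega>) \<in> borel_measurable (F_at M F T \<theta>)"
    using assms admissible_measurable by (intro borel_measurable_ereal_add) auto
next
  fix \<theta> \<theta>' assume "stopT M F T \<theta>" "stopT M F T \<theta>'"
  from admissible_AE_eq[OF assms(1) this] admissible_AE_eq[OF assms(2) this]
  show "AE \<omega> in M. \<theta> \<omega> = \<theta>' \<omega> \<longrightarrow> \<phi> \<theta> \<omega> + \<psi> \<theta> \<omega> = \<phi> \<theta>' \<omega> + \<psi> \<theta>' \<omega>"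
    by eventually_elim auto
qed

lemma admissible_uminus:
  assumes "admissible M F T \<phi>"
  shows "admissible M F T (\<lambda>\<theta> \<omega>. - \<phi> \<theta> \<omega>)"
  using assms by (auto simp: admissible_def)

lemma lower_integrable_add:
  assumes nonneg: "fam_le M F T (\<lambda>\<theta> \<omega>. 0) \<phi>" and \<psi>: "lower_integrable \<psi>"
  shows "lower_integrable (\<lambda>\<theta> \<omega>. \<phi> \<theta> \<omega> + \<psi> \<theta> \<omega>)"
  unfolding lower_integrable_def
proof (intro allI impI)
  fix \<theta> assume \<theta>: "stopT M F T \<theta>"
  have "AE \<omega> in M. 0 \<le> \<phi> \<theta> \<omega>"
    using nonneg \<theta> by (simp add: fam_le_def)
  then have "AE \<omega> in M. e2ennreal (- (\<phi> \<theta> \<omega> + \<psi> \<theta> \<omega>)) \<le> e2ennreal (- \<psi> \<theta> \<omega>)"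
  proof eventually_elim
    case (elim \<omega>)
    have "0 + \<psi> \<theta> \<omega> \<le> \<phi> \<theta> \<omega> + \<psi> \<theta> \<omega>"
      using elim by (intro add_right_mono)
    then show ?case
      by (intro e2ennreal_mono) simp
  qed
  then have "(\<integral>\<^sup>+ \<omega>. e2ennreal (- (\<phi> \<theta> \<omega> + \<psi> \<theta> \<omega>)) \<partial>M) \<le> (\<integral>\<^sup>+ \<omega>. e2ennreal (- \<psi> \<theta> \<omega>) \<partial>M)"
    by (rule nn_integral_mono_AE)
  also have "\<dots> < \<infinity>"
    using \<psi> \<theta> by (simp add: lower_integrable_def)
  finally show "(\<integral>\<^sup>+ \<omega>. e2ennreal (- (\<phi> \<theta> \<omega> + \<psi> \<theta> \<omega>)) \<partial>M) < \<infinity>" .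
qed

lemma fam_le_trans:
  assumes "fam_le M F T \<phi> \<psi>" "fam_le M F T \<psi> \<rho>"
  shows "fam_le M F T \<phi> \<rho>"
  unfolding fam_le_def
proof (intro allI impI)
  fix \<theta> assume "stopT M F T \<theta>"
  then have "AE \<omega> in M. \<phi> \<theta> \<omega> \<le> \<psi> \<theta> \<omega>" "AE \<omega> in M. \<psi> \<theta> \<omega> \<le> \<rho> \<theta> \<omega>"
    using assms by (simp_all add: fam_le_def)
  then show "AE \<omega> in M. \<phi> \<theta> \<omega> \<le> \<rho> \<theta> \<omega>"
    by eventually_elim (rule order_trans)
qed

lemma fam_le_add_right:
  assumes "fam_le M F T \<phi> \<phi>'"
  shows "fam_le M F T (\<lambda>\<theta> \<omega>. \<phi> \<theta> \<omega> + \<psi> \<theta> \<omega>) (\<lambda>\<theta> \<omega>. \<phi>' \<theta> \<omega> + \<psi> \<theta> \<omega>)"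
  unfolding fam_le_def
proof (intro allI impI)
  fix \<theta> assume "stopT M F T \<theta>"
  then have "AE \<omega> in M. \<phi> \<theta> \<omega> \<le> \<phi>' \<theta> \<omega>"
    using assms by (simp add: fam_le_def)
  then show "AE \<omega> in M. \<phi> \<theta> \<omega> + \<psi> \<theta> \<omega> \<le> \<phi>' \<theta> \<omega> + \<psi> \<theta> \<omega>"
    by eventually_elim (rule add_right_mono)
qed

text \<open>Waiting until \<open>T\<close> is allowed from every starting time, so the envelope
  dominates the conditional expectation of the terminal reward.\<close>

lemma snell_nonneg:
  assumes \<phi>: "admissible M F T \<phi>" and "AE \<omega> in M. 0 \<le> \<phi> (\<lambda>_. T) \<omega>"
  shows "fam_le M F T (\<lambda>\<theta> \<omega>. 0) (snell M F T \<phi>)"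
  unfolding fam_le_def
proof (intro allI impI)
  fix \<theta> assume \<theta>: "stopT M F T \<theta>"
  have "AE \<omega> in M. 0 \<le> cexp M (F_at M F T \<theta>) (\<phi> (\<lambda>_. T)) \<omega>"
    using sigma_finite_subalgebra.cexp_nonneg[OF sigma_finite_F_at[OF \<theta>]
        admissible_measurable2[OF \<phi> stopT_T] assms(2)] .
  with snell_upper[OF \<theta> T_in_stopT_from[OF \<theta>], of \<phi>] show "AE \<omega> in M. 0 \<le> snell M F T \<phi> \<theta> \<omega>"
    by eventually_elim (rule order_trans)
qed

lemma snell_mono:
  assumes \<phi>: "admissible M F T \<phi>" and \<psi>: "admissible M F T \<psi>" and le: "fam_le M F T \<phi> \<psi>"
  shows "fam_le M F T (snell M F T \<phi>) (snell M F T \<psi>)"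
  unfolding fam_le_def
proof (intro allI impI)
  fix \<theta> assume \<theta>: "stopT M F T \<theta>"
  show "AE \<omega> in M. snell M F T \<phi> \<theta> \<omega> \<le> snell M F T \<psi> \<theta> \<omega>"
  proof (rule snell_least[OF \<theta>])
    fix \<tau> assume \<tau>: "\<tau> \<in> stopT_from M F T \<theta>"
    then have st: "stopT M F T \<tau>"
      by (simp add: stopT_from_def)
    have "AE \<omega> in M. cexp M (F_at M F T \<theta>) (\<phi> \<tau>) \<omega> \<le> cexp M (F_at M F T \<theta>) (\<psi> \<tau>) \<omega>"
      using le st by (intro sigma_finite_subalgebra.cexp_mono[OF sigma_finite_F_at[OF \<theta>]]
          admissible_measurable2 \<phi> \<psi>) (auto simp: fam_le_def)
    with snell_upper[OF \<theta> \<tau>, of \<psi>]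
    show "AE \<omega> in M. cexp M (F_at M F T \<theta>) (\<phi> \<tau>) \<omega> \<le> snell M F T \<psi> \<theta> \<omega>"
      by eventually_elim (rule order_trans)
  qed (rule admissible_measurable2[OF admissible_snell[OF \<psi>] \<theta>])
qed

lemma snell_le_supermart_family:
  assumes \<phi>: "admissible M F T \<phi>" and H: "supermart_family M F T H" and le: "fam_le M F T \<phi> H"
  shows "fam_le M F T (snell M F T \<phi>) H"
  unfolding fam_le_def
proof (intro allI impI)
  have adm: "admissible M F T H"
    using H by (simp add: supermart_family_def)
  fix \<theta> assume \<theta>: "stopT M F T \<theta>"
  show "AE \<omega> in M. snell M F T \<phi> \<theta> \<omega> \<le> H \<theta> \<omega>"
  proof (rule snell_least[OF \<theta>])
    fix \<tau> assume "\<tau> \<in> stopT_from M F T \<theta>"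
    then have \<tau>: "stopT M F T \<tau>" "AE \<omega> in M. \<theta> \<omega> \<le> \<tau> \<omega>"
      by (simp_all add: stopT_from_def)
    have "AE \<omega> in M. cexp M (F_at M F T \<theta>) (\<phi> \<tau>) \<omega> \<le> cexp M (F_at M F T \<theta>) (H \<tau>) \<omega>"
      using le \<tau> by (intro sigma_finite_subalgebra.cexp_mono[OF sigma_finite_F_at[OF \<theta>]]
          admissible_measurable2 \<phi> adm) (auto simp: fam_le_def)
    moreover have "AE \<omega> in M. cexp M (F_at M F T \<theta>) (H \<tau>) \<omega> \<le> H \<theta> \<omega>"
      using H \<tau> \<theta> by (simp add: supermart_family_def)
    ultimately show "AE \<omega> in M. cexp M (F_at M F T \<theta>) (\<phi> \<tau>) \<omega> \<le> H \<theta> \<omega>"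
      by eventually_elim (rule order_trans)
  qed (rule admissible_measurable2[OF adm \<theta>])
qed

text \<open>The fixed point equation holds only almost surely at each stopping time, so
  \<open>J\<close> is a version of the envelope. Its supermartingale inequality is carried over by
  \<open>cexp_cong_AE\<close>.\<close>

lemma supermart_family_if_eq_snell:
  assumes \<phi>: "admissible M F T \<phi>" "lower_integrable \<phi>"
    and J: "admissible M F T J" "fam_le M F T (\<lambda>\<theta> \<omega>. 0) J" and eq: "fam_eq M F T J (snell M F T \<phi>)"
  shows "supermart_family M F T J"
  unfolding supermart_family_def
proof (intro conjI allI impI)
  fix \<theta> \<theta>' assume \<theta>: "stopT M F T \<theta>" "stopT M F T \<theta>'" and le: "AE \<omega> in M. \<theta>' \<omega> \<le> \<theta> \<omega>"
  have "AE \<omega> in M. cexp M (F_at M F T \<theta>') (J \<theta>) \<omega> = cexp M (F_at M F T \<theta>') (snell M F T \<phi> \<theta>) \<omega>"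
    using eq \<theta> by (intro sigma_finite_subalgebra.cexp_cong_AE[OF sigma_finite_F_at]
        admissible_measurable2 J admissible_snell \<phi>) (auto simp: fam_eq_def)
  moreover have "AE \<omega> in M. J \<theta>' \<omega> = snell M F T \<phi> \<theta>' \<omega>"
    using eq \<theta> by (simp add: fam_eq_def)
  ultimately show "AE \<omega> in M. cexp M (F_at M F T \<theta>') (J \<theta>) \<omega> \<le> J \<theta>' \<omega>"
    using snell_supermartingale[OF \<phi> \<theta> le] by eventually_elim simp
qed (auto intro: J int_esssup_negpart_nonneg)

section \<open>Increasing limits of families\<close>

text \<open>The upper limit matches the definitions of J and J' and makes sense on the null sets
  where the sequence fails to increase.\<close>

definition lim_family :: "(nat \<Rightarrow> 'a family) \<Rightarrow> 'a family" where
  "lim_family A = (\<lambda>\<theta> \<omega>. limsup (\<lambda>n. A n \<theta> \<omega>))"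

definition increasing_family :: "(nat \<Rightarrow> 'a family) \<Rightarrow> bool" where
  "increasing_family A \<longleftrightarrow> (\<forall>n. admissible M F T (A n)) \<and> (\<forall>n. fam_le M F T (\<lambda>\<theta> \<omega>. 0) (A n)) \<and>
    (\<forall>n. fam_le M F T (A n) (A (Suc n)))"

lemma admissible_lim_family:
  assumes "\<And>n. admissible M F T (A n)"
  shows "admissible M F T (lim_family A)"
  unfolding admissible_def lim_family_def
proof (intro conjI allI impI)
  fix \<theta> assume "stopT M F T \<theta>"
  then show "(\<lambda>\<omega>. limsup (\<lambda>n. A n \<theta> \<omega>)) \<in> borel_measurable (F_at M F T \<theta>)"
    using assms admissible_measurable by (intro borel_measurable_limsup) auto
next
  fix \<theta> \<theta>' assume "stopT M F T \<theta>" "stopT M F T \<theta>'"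
  then have "AE \<omega> in M. \<forall>n. \<theta> \<omega> = \<theta>' \<omega> \<longrightarrow> A n \<theta> \<omega> = A n \<theta>' \<omega>"
    unfolding AE_all_countable using admissible_AE_eq[OF assms] by auto
  then show "AE \<omega> in M. \<theta> \<omega> = \<theta>' \<omega> \<longrightarrow> limsup (\<lambda>n. A n \<theta> \<omega>) = limsup (\<lambda>n. A n \<theta>' \<omega>)"
    by eventually_elim auto
qed

text \<open>Countably many inequalities hold together off one null set, and there the upper limit is
  a monotone limit.\<close>

lemma lim_family_eq_SUP:
  assumes "increasing_family A" and \<theta>: "stopT M F T \<theta>"
  shows "AE \<omega> in M. lim_family A \<theta> \<omega> = (SUP n. A n \<theta> \<omega>)"
proof -
  have "AE \<omega> in M. \<forall>n. A n \<theta> \<omega> \<le> A (Suc n) \<theta> \<omega>"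
    unfolding AE_all_countable using assms by (simp add: increasing_family_def fam_le_def)
  then show ?thesis
  proof eventually_elim
    case (elim \<omega>)
    then have "(\<lambda>n. A n \<theta> \<omega>) \<longlonglongrightarrow> (SUP n. A n \<theta> \<omega>)"
      by (intro LIMSEQ_SUP incseq_SucI) auto
    then show ?case
      unfolding lim_family_def by (intro lim_imp_Limsup) auto
  qed
qed

lemma le_lim_family:
  assumes "increasing_family A"
  shows "fam_le M F T (A n) (lim_family A)"
  unfolding fam_le_def
proof (intro allI impI)
  fix \<theta> assume "stopT M F T \<theta>"
  from lim_family_eq_SUP[OF assms this] show "AE \<omega> in M. A n \<theta> \<omega> \<le> lim_family A \<theta> \<omega>"
    by eventually_elim (auto intro: SUP_upper)
qed

lemma lim_family_le:
  assumes "increasing_family A" "\<And>n. fam_le M F T (A n) \<phi>"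
  shows "fam_le M F T (lim_family A) \<phi>"
  unfolding fam_le_def
proof (intro allI impI)
  fix \<theta> assume \<theta>: "stopT M F T \<theta>"
  then have "AE \<omega> in M. \<forall>n. A n \<theta> \<omega> \<le> \<phi> \<theta> \<omega>"
    unfolding AE_all_countable using assms(2) by (simp add: fam_le_def)
  with lim_family_eq_SUP[OF assms(1) \<theta>] show "AE \<omega> in M. lim_family A \<theta> \<omega> \<le> \<phi> \<theta> \<omega>"
    by eventually_elim (auto intro: SUP_least)
qed

lemma lim_family_nonneg:
  assumes "increasing_family A"
  shows "fam_le M F T (\<lambda>\<theta> \<omega>. 0) (lim_family A)"
  using fam_le_trans[OF _ le_lim_family[OF assms, of 0]] assms by (simp add: increasing_family_def)

text \<open>Exchanges the suprema over \<open>n\<close> and over stopping times: monotonicity of the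
  envelope gives one inequality, conditional monotone convergence at each fixed stopping time the
  other. The general \<psi> lets both fixed point equations follow by swapping the two
  sequences.\<close>

lemma lim_family_eq_snell:
  assumes A: "increasing_family A" and B: "increasing_family B"
    and \<psi>: "admissible M F T \<psi>" "lower_integrable \<psi>"
    and step: "\<And>n. B (Suc n) = snell M F T (\<lambda>\<theta> \<omega>. A n \<theta> \<omega> + \<psi> \<theta> \<omega>)"
  shows "fam_eq M F T (lim_family B) (snell M F T (\<lambda>\<theta> \<omega>. lim_family A \<theta> \<omega> + \<psi> \<theta> \<omega>))"
proof -
  let ?R = "snell M F T (\<lambda>\<theta> \<omega>. lim_family A \<theta> \<omega> + \<psi> \<theta> \<omega>)"
  have admA: "admissible M F T (A n)" and admB: "admissible M F T (B n)"
    and A0: "fam_le M F T (\<lambda>\<theta> \<omega>. 0) (A n)"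
    and incA: "fam_le M F T (A n) (A (Suc n))" and incB: "fam_le M F T (B n) (B (Suc n))" for n
    using A B by (simp_all add: increasing_family_def)
  have "fam_le M F T (B (Suc n)) ?R" for n
    unfolding step
    by (intro snell_mono admissible_add admissible_lim_family admA \<psi> fam_le_add_right le_lim_family A)
  \<comment> \<open>\<open>B 0\<close> is not covered by \<open>step\<close>, so each
    \<open>B n\<close> is bounded through its successor.\<close>
  then have le: "fam_le M F T (lim_family B) ?R"
    by (intro lim_family_le B) (rule fam_le_trans[OF incB])
  have ge: "AE \<omega> in M. ?R \<theta> \<omega> \<le> lim_family B \<theta> \<omega>" if \<theta>: "stopT M F T \<theta>" for \<theta>
  proof (rule snell_least[OF \<theta>])
    interpret N: sigma_finite_subalgebra M "F_at M F T \<theta>"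
      by (rule sigma_finite_F_at[OF \<theta>])
    show "lim_family B \<theta> \<in> borel_measurable M"
      by (intro admissible_measurable2 admissible_lim_family admB \<theta>)
    fix \<tau> assume \<tau>: "\<tau> \<in> stopT_from M F T \<theta>"
    then have st: "stopT M F T \<tau>"
      by (simp add: stopT_from_def)
    have [measurable]: "A n \<tau> \<in> borel_measurable M" "\<psi> \<tau> \<in> borel_measurable M"
      "lim_family A \<tau> \<in> borel_measurable M" for n
      by (intro admissible_measurable2 admissible_lim_family admA \<psi> st)+
    \<comment> \<open>Adding -\<infinity> need not commute with the supremum: all sums may be
      -\<infinity> while the limit of the \<open>A n\<close> is \<infinity>, where the sum is
      \<infinity>. Integrability of the negative part excludes this almost surely.\<close>
    have "AE \<omega> in M. e2ennreal (- \<psi> \<tau> \<omega>) \<noteq> \<infinity>"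
      using \<psi>(2) st by (intro nn_integral_PInf_AE) (auto simp: lower_integrable_def less_top)
    with lim_family_eq_SUP[OF A st]
    have "AE \<omega> in M. lim_family A \<tau> \<omega> + \<psi> \<tau> \<omega> = (SUP n. A n \<tau> \<omega> + \<psi> \<tau> \<omega>)"
    proof eventually_elim
      case (elim \<omega>)
      then have "\<psi> \<tau> \<omega> \<noteq> - \<infinity>"
        by auto
      then show ?case
        using elim by (simp add: SUP_ereal_add_left)
    qed
    then have "AE \<omega> in M. cexp M (F_at M F T \<theta>) (\<lambda>\<omega>. lim_family A \<tau> \<omega> + \<psi> \<tau> \<omega>) \<omega>
        = cexp M (F_at M F T \<theta>) (\<lambda>\<omega>. SUP n. A n \<tau> \<omega> + \<psi> \<tau> \<omega>) \<omega>"
      by (intro N.cexp_cong_AE) auto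
    moreover have "AE \<omega> in M. cexp M (F_at M F T \<theta>) (\<lambda>\<omega>. SUP n. A n \<tau> \<omega> + \<psi> \<tau> \<omega>) \<omega>
        = (SUP n. cexp M (F_at M F T \<theta>) (\<lambda>\<omega>. A n \<tau> \<omega> + \<psi> \<tau> \<omega>) \<omega>)"
    proof (rule N.cexp_monotone_convergence)
      show "AE \<omega> in M. A n \<tau> \<omega> + \<psi> \<tau> \<omega> \<le> A (Suc n) \<tau> \<omega> + \<psi> \<tau> \<omega>" for n
        using fam_le_add_right[OF incA] st by (simp add: fam_le_def)
      show "(\<integral>\<^sup>+ \<omega>. e2ennreal (- (A 0 \<tau> \<omega> + \<psi> \<tau> \<omega>)) \<partial>M) < \<infinity>"
        using lower_integrable_add[OF A0 \<psi>(2)] st by (simp add: lower_integrable_def)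
    qed measurable
    \<comment> \<open>The reward at level \<open>n\<close> bounds \<open>B\<close> from below at
      level \<open>Suc n\<close>; the shift disappears in the limit.\<close>
    moreover have "AE \<omega> in M. \<forall>n. cexp M (F_at M F T \<theta>) (\<lambda>\<omega>. A n \<tau> \<omega> + \<psi> \<tau> \<omega>) \<omega> \<le> B (Suc n) \<theta> \<omega>"
      unfolding AE_all_countable step
      using snell_upper[OF \<theta> \<tau>, where \<phi>="\<lambda>\<theta> \<omega>. A _ \<theta> \<omega> + \<psi> \<theta> \<omega>"] by (intro allI)
    moreover have "AE \<omega> in M. \<forall>n. B (Suc n) \<theta> \<omega> \<le> lim_family B \<theta> \<omega>"
      unfolding AE_all_countable using le_lim_family[OF B] \<theta> by (auto simp: fam_le_def)
    ultimately show "AE \<omega> in M. cexp M (F_at M F T \<theta>) (\<lambda>\<omega>. lim_family A \<tau> \<omega> + \<psi> \<tau> \<omega>) \<omega>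
        \<le> lim_family B \<theta> \<omega>"
      by eventually_elim (auto intro!: SUP_least intro: order_trans)
  qed
  show ?thesis
    unfolding fam_eq_def
  proof (intro allI impI)
    fix \<theta> assume \<theta>: "stopT M F T \<theta>"
    then have "AE \<omega> in M. lim_family B \<theta> \<omega> \<le> ?R \<theta> \<omega>"
      using le by (simp add: fam_le_def)
    with ge[OF \<theta>] show "AE \<omega> in M. lim_family B \<theta> \<omega> = ?R \<theta> \<omega>"
      by eventually_elim (rule antisym)
  qed
qed

end

section \<open>The minimal solution\<close>

theorem theorem2p3:
  fixes M :: "'a measure" and F :: "real \<Rightarrow> 'a measure" and T :: real
    and \<xi> \<zeta> :: "'a family"
  assumes setting: "usual_filtered_space M F T"
    and adm_xi: "admissible M F T \<xi>" and adm_zeta: "admissible M F T \<zeta>"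
    and int_xi: "int_esssup M F T negpart \<xi>"
    and int_zeta: "int_esssup M F T pospart \<zeta>"
    and xi_T: "AE \<omega> in M. \<xi> (\<lambda>_. T) \<omega> = 0"
    and zeta_T: "AE \<omega> in M. \<zeta> (\<lambda>_. T) \<omega> = 0"
  shows "supermart_family M F T (Jfam M F T \<xi> \<zeta>)
       \<and> supermart_family M F T (Jfam' M F T \<xi> \<zeta>)
       \<and> fam_le M F T (\<lambda>\<theta> \<omega>. 0) (Jfam M F T \<xi> \<zeta>)
       \<and> fam_le M F T (\<lambda>\<theta> \<omega>. 0) (Jfam' M F T \<xi> \<zeta>)
       \<and> fam_eq M F T (Jfam M F T \<xi> \<zeta>)
           (snell M F T (\<lambda>\<tau> \<omega>. Jfam' M F T \<xi> \<zeta> \<tau> \<omega> + \<xi> \<tau> \<omega>))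
       \<and> fam_eq M F T (Jfam' M F T \<xi> \<zeta>)
           (snell M F T (\<lambda>\<sigma> \<omega>. Jfam M F T \<xi> \<zeta> \<sigma> \<omega> - \<zeta> \<sigma> \<omega>))
       \<and> (\<forall>H H'. supermart_family M F T H \<and> supermart_family M F T H'
              \<and> fam_le M F T (\<lambda>\<theta> \<omega>. 0) H \<and> fam_le M F T (\<lambda>\<theta> \<omega>. 0) H'
              \<and> fam_le M F T (\<lambda>\<theta> \<omega>. H' \<theta> \<omega> + \<xi> \<theta> \<omega>) H
              \<and> fam_le M F T (\<lambda>\<theta> \<omega>. H \<theta> \<omega> - \<zeta> \<theta> \<omega>) H'
              \<longrightarrow> fam_le M F T (Jfam M F T \<xi> \<zeta>) H \<and> fam_le M F T (Jfam' M F T \<xi> \<zeta>) H')"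
proof -
  interpret usual_filtration M F T
    by unfold_locales fact
  \<comment> \<open>With \<eta> = -\<zeta> both recursions add a fixed family to an iterate, so each
    lemma covers both.\<close>
  define \<eta> where "\<eta> = (\<lambda>\<theta> \<omega>. - \<zeta> \<theta> \<omega>)"
  define A where "A n = fst (Jseq M F T \<xi> \<zeta> n)" for n
  define A' where "A' n = snd (Jseq M F T \<xi> \<zeta> n)" for n
  have minus: "\<phi> \<theta> \<omega> - \<zeta> \<theta> \<omega> = \<phi> \<theta> \<omega> + \<eta> \<theta> \<omega>" for \<phi> :: "'a family" and \<theta> \<omega>
    by (simp add: \<eta>_def minus_ereal_def)
  have J: "Jfam M F T \<xi> \<zeta> = lim_family A" "Jfam' M F T \<xi> \<zeta> = lim_family A'"
    by (simp_all add: Jfam_def Jfam'_def lim_family_def A_def A'_def)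
  have A_0: "A 0 = (\<lambda>\<theta> \<omega>. 0)" "A' 0 = (\<lambda>\<theta> \<omega>. 0)"
    by (simp_all add: A_def A'_def)
  have A_Suc: "A (Suc n) = snell M F T (\<lambda>\<theta> \<omega>. A' n \<theta> \<omega> + \<xi> \<theta> \<omega>)"
    and A'_Suc: "A' (Suc n) = snell M F T (\<lambda>\<theta> \<omega>. A n \<theta> \<omega> + \<eta> \<theta> \<omega>)" for n
    by (simp_all add: A_def A'_def minus)

  have \<xi>: "admissible M F T \<xi>" "lower_integrable \<xi>"
    using adm_xi int_xi lower_integrable_if_int_esssup by auto
  \<comment> \<open>The negative part of -\<zeta> is the positive part of \<zeta>.\<close>
  have "int_esssup M F T negpart \<eta>"
    using int_zeta by (simp add: int_esssup_def \<eta>_def negpart_def pospart_def)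
  moreover have "admissible M F T \<eta>"
    unfolding \<eta>_def by (rule admissible_uminus[OF adm_zeta])
  ultimately have \<eta>: "admissible M F T \<eta>" "lower_integrable \<eta>"
    using lower_integrable_if_int_esssup by auto
  have \<eta>_T: "AE \<omega> in M. \<eta> (\<lambda>_. T) \<omega> = 0"
    using zeta_T by eventually_elim (simp add: \<eta>_def)

  have nonneg_T: "AE \<omega> in M. 0 \<le> \<phi> (\<lambda>_. T) \<omega> + \<psi> (\<lambda>_. T) \<omega>"
    if "fam_le M F T (\<lambda>\<theta> \<omega>. 0) \<phi>" "AE \<omega> in M. \<psi> (\<lambda>_. T) \<omega> = 0" for \<phi> \<psi>
  proof -
    have "AE \<omega> in M. 0 \<le> \<phi> (\<lambda>_. T) \<omega>"
      using that(1) stopT_T by (simp add: fam_le_def)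
    with that(2) show ?thesis
      by eventually_elim simp
  qed
  have adm: "admissible M F T (A n) \<and> admissible M F T (A' n)" for n
  proof (induction n)
    case 0
    show ?case
      by (simp add: A_0 admissible_def)
  next
    case (Suc n)
    then show ?case
      by (simp add: A_Suc A'_Suc admissible_snell admissible_add \<xi> \<eta>)
  qed
  have nonneg: "fam_le M F T (\<lambda>\<theta> \<omega>. 0) (A n) \<and> fam_le M F T (\<lambda>\<theta> \<omega>. 0) (A' n)" for n
  proof (induction n)
    case 0
    show ?case
      by (simp add: A_0 fam_le_def)
  next
    case (Suc n)
    then show ?case
      unfolding A_Suc A'_Suc
      by (intro conjI snell_nonneg admissible_add nonneg_T) (auto simp: adm \<xi> \<eta> xi_T \<eta>_T)
  qed
  have inc: "fam_le M F T (A n) (A (Suc n)) \<and> fam_le M F T (A' n) (A' (Suc n))" for n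
  proof (induction n)
    case 0
    \<comment> \<open>The zeroth iterates are 0, so the base case is nonnegativity of the first
      ones.\<close>
    show ?case
      using nonneg[of "Suc 0"] by (simp add: A_0)
  next
    case (Suc n)
    then show ?case
      unfolding A_Suc A'_Suc
      by (intro conjI snell_mono admissible_add fam_le_add_right)
        (simp_all add: adm \<xi> \<eta> flip: A_Suc A'_Suc)
  qed
  have A: "increasing_family A" and A': "increasing_family A'"
    using adm nonneg inc by (simp_all add: increasing_family_def)

  have eq: "fam_eq M F T (lim_family A) (snell M F T (\<lambda>\<theta> \<omega>. lim_family A' \<theta> \<omega> + \<xi> \<theta> \<omega>))"
    "fam_eq M F T (lim_family A') (snell M F T (\<lambda>\<theta> \<omega>. lim_family A \<theta> \<omega> + \<eta> \<theta> \<omega>))"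
    using lim_family_eq_snell[OF A' A \<xi> A_Suc] lim_family_eq_snell[OF A A' \<eta> A'_Suc] .
  have "supermart_family M F T (lim_family A)"
    by (rule supermart_family_if_eq_snell[OF _ _ _ _ eq(1)])
      (simp_all add: admissible_add lower_integrable_add admissible_lim_family lim_family_nonneg adm \<xi> A A')
  moreover have "supermart_family M F T (lim_family A')"
    by (rule supermart_family_if_eq_snell[OF _ _ _ _ eq(2)])
      (simp_all add: admissible_add lower_integrable_add admissible_lim_family lim_family_nonneg adm \<eta> A A')
  moreover have "\<forall>H H'. supermart_family M F T H \<and> supermart_family M F T H'
      \<and> fam_le M F T (\<lambda>\<theta> \<omega>. 0) H \<and> fam_le M F T (\<lambda>\<theta> \<omega>. 0) H'
      \<and> fam_le M F T (\<lambda>\<theta> \<omega>. H' \<theta> \<omega> + \<xi> \<theta> \<omega>) H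
      \<and> fam_le M F T (\<lambda>\<theta> \<omega>. H \<theta> \<omega> + \<eta> \<theta> \<omega>) H'
    \<longrightarrow> fam_le M F T (lim_family A) H \<and> fam_le M F T (lim_family A') H'"
  proof (intro allI impI)
    fix H H'
    assume "supermart_family M F T H \<and> supermart_family M F T H'
      \<and> fam_le M F T (\<lambda>\<theta> \<omega>. 0) H \<and> fam_le M F T (\<lambda>\<theta> \<omega>. 0) H'
      \<and> fam_le M F T (\<lambda>\<theta> \<omega>. H' \<theta> \<omega> + \<xi> \<theta> \<omega>) H
      \<and> fam_le M F T (\<lambda>\<theta> \<omega>. H \<theta> \<omega> + \<eta> \<theta> \<omega>) H'"
    then have H: "supermart_family M F T H" "supermart_family M F T H'"
      "fam_le M F T (\<lambda>\<theta> \<omega>. 0) H" "fam_le M F T (\<lambda>\<theta> \<omega>. 0) H'"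
      "fam_le M F T (\<lambda>\<theta> \<omega>. H' \<theta> \<omega> + \<xi> \<theta> \<omega>) H" "fam_le M F T (\<lambda>\<theta> \<omega>. H \<theta> \<omega> + \<eta> \<theta> \<omega>) H'"
      by simp_all
    \<comment> \<open>Nonnegativity of \<open>H\<close> and \<open>H'\<close> starts the induction.
      In the step, \<open>A' n + \<xi> \<le> H' + \<xi> \<le> H\<close>, so \<open>H\<close>
      dominates the reward whose envelope is the next \<open>A\<close>; the other bound is
      symmetric.\<close>
    have "fam_le M F T (A n) H \<and> fam_le M F T (A' n) H'" for n
    proof (induction n)
      case 0
      show ?case
        using H by (simp add: A_0)
    next
      case (Suc n)
      have "fam_le M F T (\<lambda>\<theta> \<omega>. A' n \<theta> \<omega> + \<xi> \<theta> \<omega>) H" "fam_le M F T (\<lambda>\<theta> \<omega>. A n \<theta> \<omega> + \<eta> \<theta> \<omega>) H'"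
        using Suc fam_le_trans[OF fam_le_add_right H(5)] fam_le_trans[OF fam_le_add_right H(6)] by auto
      then show ?case
        unfolding A_Suc A'_Suc
        by (intro conjI snell_le_supermart_family admissible_add H) (auto simp: adm \<xi> \<eta>)
    qed
    then show "fam_le M F T (lim_family A) H \<and> fam_le M F T (lim_family A') H'"
      by (intro conjI lim_family_le A A') auto
  qed
  ultimately show ?thesis
    unfolding J minus
    using lim_family_nonneg[OF A] lim_family_nonneg[OF A'] eq by (intro conjI)
qed

end
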